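(* Let $p \equiv 3 \pmod 4$ be a prime and write $p+1 = 2^k n$ with $k \in \mathbb{Z}$, $k \geq 2$, and $n$ an odd integer. Let $m$ be an integer that is a quadratic non-residue modulo $p$, and let $E$ be the elliptic curve over $\mathbb{F}_p$ defined by $y^2 = x^3 - mx$, so that $E(\mathbb{F}_p)$ is cyclic of order $2^k n$. If $Q = (x,y) \in E(\mathbb{F}_p)$ and $x$ is a quadratic non-residue modulo $p$, then the order of $Q$ in $E(\mathbb{F}_p)$ is divisible by $2^k$.
   Context: $E(\mathbb{F}_p)$ is the group of $\mathbb{F}_p$-rational points of $E$ with the usual elliptic curve group law. *)

theory Defs
  imports "HOL-Number_Theory.Number_Theory"
begin

datatype 'a ec_point = Infinity | Point 'a 'a

text \<open>
  The rational points of \<open>y\<^sup>2 = x\<^sup>3 + a x + b\<close> over a field \<open>R\<close>, including the point at infinity.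
\<close>

definition ec_points :: "('a, 'r) ring_scheme \<Rightarrow> 'a \<Rightarrow> 'a \<Rightarrow> 'a ec_point set" where
  "ec_points R a b =
     {Infinity} \<union>
     {Point x y | x y. x \<in> carrier R \<and> y \<in> carrier R \<and>
        y [^]\<^bsub>R\<^esub> (2::nat) = x [^]\<^bsub>R\<^esub> (3::nat) \<oplus>\<^bsub>R\<^esub> a \<otimes>\<^bsub>R\<^esub> x \<oplus>\<^bsub>R\<^esub> b}"

text \<open>
  The third intersection point of the line of slope \<open>l\<close> through \<open>(x1, y1)\<close> and a
  second point with abscissa \<open>x2\<close>, reflected in the x-axis.
\<close>

definition ec_chord :: "('a, 'r) ring_scheme \<Rightarrow> 'a \<Rightarrow> 'a \<Rightarrow> 'a \<Rightarrow> 'a \<Rightarrow> 'a ec_point" where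
  "ec_chord R l x1 y1 x2 =
     (let x3 = l [^]\<^bsub>R\<^esub> (2::nat) \<ominus>\<^bsub>R\<^esub> x1 \<ominus>\<^bsub>R\<^esub> x2
      in Point x3 (l \<otimes>\<^bsub>R\<^esub> (x1 \<ominus>\<^bsub>R\<^esub> x3) \<ominus>\<^bsub>R\<^esub> y1))"

text \<open>
  The chord-and-tangent law (characteristic not 2). For two points on the curve with
  \<open>x1 = x2\<close> and \<open>y1 \<noteq> - y2\<close> one has \<open>y1 = y2 \<noteq> 0\<close>, and the tangent there has
  slope \<open>(3 x1\<^sup>2 + a) / (2 y1)\<close>.
\<close>

fun ec_add :: "('a, 'r) ring_scheme \<Rightarrow> 'a \<Rightarrow> 'a ec_point \<Rightarrow> 'a ec_point \<Rightarrow> 'a ec_point" where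
  "ec_add R a Infinity Q = Q"
| "ec_add R a (Point x1 y1) Infinity = Point x1 y1"
| "ec_add R a (Point x1 y1) (Point x2 y2) =
     (if x1 = x2 then
        if y1 = \<ominus>\<^bsub>R\<^esub> y2 then Infinity
        else ec_chord R
          ((x1 [^]\<^bsub>R\<^esub> (2::nat) \<oplus>\<^bsub>R\<^esub> x1 [^]\<^bsub>R\<^esub> (2::nat) \<oplus>\<^bsub>R\<^esub> x1 [^]\<^bsub>R\<^esub> (2::nat) \<oplus>\<^bsub>R\<^esub> a)
            \<otimes>\<^bsub>R\<^esub> inv\<^bsub>R\<^esub> (y1 \<oplus>\<^bsub>R\<^esub> y1))
          x1 y1 x2
      else ec_chord R ((y2 \<ominus>\<^bsub>R\<^esub> y1) \<otimes>\<^bsub>R\<^esub> inv\<^bsub>R\<^esub> (x2 \<ominus>\<^bsub>R\<^esub> x1)) x1 y1 x2)"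

definition ec_group :: "('a, 'r) ring_scheme \<Rightarrow> 'a \<Rightarrow> 'a \<Rightarrow> 'a ec_point monoid" where
  "ec_group R a b =
     \<lparr>carrier = ec_points R a b, monoid.mult = ec_add R a, one = Infinity\<rparr>"

text \<open>
  \<open>E(F\<^sub>p)\<close> for \<open>E: y\<^sup>2 = x\<^sup>3 - m x\<close>. The discriminant is \<open>64 m\<^sup>3\<close>, so \<open>E\<close> is
  nonsingular whenever \<open>p\<close> is odd and does not divide \<open>m\<close>; a number \<open>m\<close> with
  \<open>\<not> QuadRes p m\<close> is never divisible by \<open>p\<close>, since \<open>QuadRes p 0\<close> holds.
\<close>

definition E_group :: "nat \<Rightarrow> int \<Rightarrow> int ec_point monoid" where
  "E_group p m = ec_group (residue_ring (int p)) ((- m) mod int p) 0"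

end

theory Submission
  imports Defs "HOL-Algebra.Sylow"
begin

text \<open>
  Since \<open>-1\<close> is a non-residue, \<open>-m = e\<^sup>2\<close> with \<open>2 e = w\<^sup>2\<close> for a suitable choice of the sign of \<open>e\<close>. Then
  \<open>(x, y) \<mapsto> (w x / y, (x - e) / (x + e))\<close> embeds \<open>E\<close> into the Edwards curve \<open>X\<^sup>2 + Y\<^sup>2 + X\<^sup>2 Y\<^sup>2 = 1\<close> and turns
  the chord-and-tangent law into the Edwards addition law. That law has no exceptional cases, because
  \<open>-1\<close> is a non-residue, and its associativity is a single polynomial identity; so \<open>E(F\<^sub>p)\<close> is an
  abelian group. It has \<open>p + 1\<close> points by pairing \<open>x\<close> with \<open>-x\<close>, its only involution is \<open>(0, 0)\<close>,
  and the abscissa of a double is a square, so \<open>Q\<close> is not a double. In a finite abelian group \<open>G\<close>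
  with at most one involution, every non-double \<open>Q\<close> generates a subgroup of odd index: a coset of
  order two in \<open>G / \<langle>Q\<rangle>\<close> would make \<open>Q\<close> a double or yield a second involution. Hence \<open>2\<^sup>k\<close>
  divides the order of \<open>Q\<close>.
\<close>

section \<open>Involutions and quadratic characters\<close>

text \<open>Cauchy's theorem for the prime two: Sylow with exponent 1 gives a subgroup of order two,
  and its nontrivial element squares to one by Lagrange.\<close>

lemma (in group) exists_involution:
  assumes "finite (carrier G)" "even (order G)"
  shows "\<exists>g \<in> carrier G. g \<noteq> \<one> \<and> g \<otimes> g = \<one>"
proof -
  obtain m where "order G = 2 ^ 1 * m"
    using assms(2) by auto
  then obtain H where H: "subgroup H G" "card H = 2"
    using sylow_thm[of 2 G 1 m] assms(1) group_axioms by auto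
  interpret H: group "G\<lparr>carrier := H\<rparr>"
    using H(1) by (rule subgroup_imp_group)
  obtain g where g: "g \<in> H" "g \<noteq> \<one>"
    using H(2) by (metis card_2_iff' )
  have "g [^] card H = \<one>"
    using H.pow_order_eq_1[of g] g(1) by (simp add: order_def nat_pow_consistent[symmetric])
  then show ?thesis
    using g H subgroup.mem_carrier[OF H(1)] by (auto simp: numeral_2_eq_2)
qed

text \<open>By Lagrange \<open>order G\<close> is the index of the subgroup generated by
  \<open>q\<close> times \<open>ord q\<close>, so it suffices that this index is odd.\<close>

lemma (in comm_group) ord_dvd_of_unique_involution:
  assumes fin: "finite (carrier G)"
    and invol: "\<And>g h. \<lbrakk>g \<in> carrier G; h \<in> carrier G; g \<otimes> g = \<one>; h \<otimes> h = \<one>; g \<noteq> \<one>; h \<noteq> \<one>\<rbrakk> \<Longrightarrow> g = h"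
    and q: "q \<in> carrier G" and nsq: "\<And>r. r \<in> carrier G \<Longrightarrow> r \<otimes> r \<noteq> q"
    and "2 ^ k dvd order G"
  shows "2 ^ k dvd ord q"
proof -
  have pow_sq: "q [^] j \<otimes> q [^] j = q [^] (2 * j)" for j :: nat
    using q by (simp add: nat_pow_mult mult_2)
  have "even (ord q)"
  proof (rule ccontr)
    assume "odd (ord q)"
    then obtain j where "ord q = 2 * j + 1" by (rule oddE)
    \<comment> \<open>For order \<open>2 * j + 1\<close> the power \<open>q [^] (j + 1)\<close>
      would be a square root of \<open>q\<close>.\<close>
    then have "q [^] (j + 1) \<otimes> q [^] (j + 1) = q [^] ord q \<otimes> q"
      using q unfolding pow_sq by simp
    then show False
      using nsq[of "q [^] (j + 1)"] q by simp
  qed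
  then obtain d where d: "ord q = 2 * d" by auto
  have "ord q > 0"
    using ord_ge_1[OF fin q] by simp
  then have "q [^] d \<noteq> \<one>"
    using pow_eq_id[OF q, of d] d by (auto dest: dvd_imp_le)
  moreover have "q [^] d \<otimes> q [^] d = \<one>"
    using q pow_sq[of d] d by (metis pow_ord_eq_1)
  ultimately have t: "g = q [^] d" if "g \<in> carrier G" "g \<otimes> g = \<one>" "g \<noteq> \<one>" for g
    using invol[of g "q [^] d"] that q by simp
  define H where "H = generate G {q}"
  have H: "subgroup H G" unfolding H_def
    using q by (simp add: generate_is_subgroup)
  have H_pow: "H = {q [^] (j::nat) | j. True}"
    unfolding H_def using generate_pow_on_finite_carrier[OF fin q] by simp
  have "H \<lhd> G"
    using H normal_iff_subgroup by blast
  then interpret normal H G .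
  interpret Q: group "G Mod H" by (rule factorgroup_is_group)
  have "odd (order (G Mod H))"
  proof
    assume "even (order (G Mod H))"
    moreover have "finite (carrier (G Mod H))"
      using fin by (auto simp: FactGroup_def RCOSETS_def)
    ultimately obtain c where c: "c \<in> carrier (G Mod H)" "c \<noteq> H" "c <#> c = H"
      using Q.exists_involution by auto
    then obtain g where g: "g \<in> carrier G" "c = H #> g"
      by (auto simp: FactGroup_def RCOSETS_def)
    have "H #> (g \<otimes> g) = H"
      using c(3) g rcos_sum by auto
    then have "g \<otimes> g \<in> H"
      using rcos_self[OF _ H, of "g \<otimes> g"] g(1) by simp
    then obtain j :: nat where j: "g \<otimes> g = q [^] j"
      by (auto simp: H_pow)
    \<comment> \<open>Dividing \<open>g\<close> by \<open>q [^] i\<close> stays in its coset and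
      reduces the exponent to the parity of \<open>j\<close>. If it is even, \<open>r\<close> is one
      or the involution \<open>q [^] d\<close>, so \<open>g\<close> lies in \<open>H\<close>; if it
      is odd, \<open>q\<close> is a square.\<close>
    define i where "i = j div 2"
    define r where "r = g \<otimes> inv (q [^] i)"
    have r: "r \<in> carrier G" using g q by (simp add: r_def)
    have gr: "g = r \<otimes> q [^] i" using g q by (simp add: r_def m_assoc)
    have "(r \<otimes> r) \<otimes> q [^] (2 * i) = q [^] j"
      using j r q unfolding gr pow_sq[symmetric] by (simp add: m_ac)
    moreover have "q [^] j = q [^] (j mod 2) \<otimes> q [^] (2 * i)"
      using q by (simp add: nat_pow_mult i_def)
    ultimately have rr: "r \<otimes> r = q [^] (j mod 2)"
      using r q by simp
    show False
    proof (cases "even j")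
      case True
      then have "r = \<one> \<or> r = q [^] d"
        using rr t[OF r] by auto
      then have "r \<in> H" using H_pow by (metis (mono_tags, lifting) mem_Collect_eq nat_pow_0)
      moreover have "q [^] i \<in> H" using H_pow by blast
      ultimately have "g \<in> H" unfolding gr by (rule m_closed)
      then show False using c(2) g coset_join2[OF g(1) H] by simp
    next
      case False
      then have "r \<otimes> r = q" using rr q by (simp add: odd_iff_mod_2_eq_one)
      then show False using nsq r by simp
    qed
  qed
  then have "coprime (2 ^ k) (order (G Mod H))" by simp
  moreover have "order (G Mod H) * ord q = order G"
    using lagrange[OF H] generate_pow_card[OF q]
    by (simp add: order_def FactGroup_def H_def)
  ultimately show ?thesis
    using assms(5) by (metis coprime_dvd_mult_right_iff)
qed

text \<open>Euler's criterion: the exponent \<open>(p - 1) div 2\<close> is odd, so negating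
  \<open>a\<close> flips the Legendre symbol.\<close>

lemma QuadRes_uminus_iff:
  fixes p :: nat and a :: int
  assumes p: "prime p" "[p = 3] (mod 4)" and a: "\<not> int p dvd a"
  shows "QuadRes (int p) (- a) \<longleftrightarrow> \<not> QuadRes (int p) a"
proof -
  have p4: "p mod 4 = 3" using p(2) by (simp add: cong_def)
  then have p2: "2 < p" by presburger
  have "odd ((p - 1) div 2)" using p4 by presburger
  then have "(- a) ^ ((p - 1) div 2) = - (a ^ ((p - 1) div 2))" by simp
  with euler_criterion[OF p(1) p2, of a] euler_criterion[OF p(1) p2, of "- a"]
  have "[Legendre (- a) p = - Legendre a p] (mod p)"
    by (metis cong_minus_minus_iff cong_sym cong_trans)
  moreover have "\<not> [a = 0] (mod p)" "\<not> [- a = 0] (mod p)"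
    using a by (auto simp: cong_0_iff)
  \<comment> \<open>The symbols 1 and -1 must stay distinct modulo \<open>p\<close>.\<close>
  moreover have "\<not> int p dvd 2" using p2 zdvd_not_zless[of 2 "int p"] by simp
  ultimately show ?thesis
    by (auto simp: Legendre_def cong_iff_dvd_diff split: if_splits)
qed

section \<open>The Edwards curve\<close>

text \<open>
  The abscissae of \<open>(P\<^sub>1 + P\<^sub>2) + P\<^sub>3\<close> and \<open>P\<^sub>1 + (P\<^sub>2 + P\<^sub>3)\<close>, with denominators cleared, differ by a
  combination of the three curve equations; the cofactors come from reduction by the leading monomials
  \<open>X\<^sub>i\<^sup>2 Y\<^sub>i\<^sup>2\<close>.
\<close>

lemma edwards_assoc_identity:
  fixes X1 Y1 X2 Y2 X3 Y3 :: int
  defines "N \<equiv> X1 * Y2 + X2 * Y1" and "N' \<equiv> Y1 * Y2 - X1 * X2" and "t \<equiv> X1 * X2 * Y1 * Y2"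
    and "M \<equiv> X2 * Y3 + X3 * Y2" and "M' \<equiv> Y2 * Y3 - X2 * X3" and "u \<equiv> X2 * X3 * Y2 * Y3"
  shows "((1 - t) * (1 + t) - N * N' * X3 * Y3) * (X1 * M' * (1 - u) + M * Y1 * (1 + u))
       - ((1 - u) * (1 + u) - M * M' * X1 * Y1) * (N * Y3 * (1 + t) + X3 * N' * (1 - t)) =
      X2 * Y2 * (- X1*X2^3*Y2^2*X3^2*Y3 - X1*X2^3*X3^2*Y3 + X1*X2^2*Y2^3*X3*Y3^2 - X1*X2^2*Y2*X3^3
        + X1*X2^2*Y2*X3 + X1*X2*Y2^2*Y3^3 - X1*X2*Y2^2*Y3 + X1*Y2^3*X3*Y3^2 - Y1*X2^3*Y2^2*X3*Y3^2
        - Y1*X2^3*X3*Y3^2 - Y1*X2^2*Y2^3*X3^2*Y3 + Y1*X2^2*Y2*Y3^3 - Y1*X2^2*Y2*Y3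
        + Y1*X2*Y2^2*X3^3 - Y1*X2*Y2^2*X3 - Y1*Y2^3*X3^2*Y3)
        * (X1^2 + Y1^2 + X1^2 * Y1^2 - 1)
    + X2 * Y2 * (X1^3*X2*X3^2*Y3 - X1^3*Y2*X3*Y3^2 - X1^2*Y1*X2*X3^3 + X1^2*Y1*X2*X3
        - X1^2*Y1*Y2*Y3^3 + X1^2*Y1*Y2*Y3 - X1*Y1^2*X2*Y3^3 + X1*Y1^2*X2*Y3 + X1*Y1^2*Y2*X3^3
        - X1*Y1^2*Y2*X3 - X1*X2*X3^2*Y3 + X1*Y2*X3*Y3^2 + Y1^3*X2*X3*Y3^2 + Y1^3*Y2*X3^2*Y3
        - Y1*X2*X3*Y3^2 - Y1*Y2*X3^2*Y3)
        * (X2^2 + Y2^2 + X2^2 * Y2^2 - 1)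
    + X2 * Y2 * (X1^3*X2^2*Y2*X3 - X1^3*X2*Y2^2*Y3 + X1^2*Y1*X2^3*Y2^2*X3 + X1^2*Y1*X2^3*X3
        + X1^2*Y1*X2^2*Y2^3*Y3 + X1^2*Y1*Y2^3*Y3 + X1*Y1^2*X2^3*Y2^2*Y3 + X1*Y1^2*X2^3*Y3
        - X1*Y1^2*X2^2*Y2^3*X3 - X1*Y1^2*Y2^3*X3 - X1*X2^2*Y2*X3 + X1*X2*Y2^2*Y3
        - Y1^3*X2^2*Y2*Y3 - Y1^3*X2*Y2^2*X3 + Y1*X2^2*Y2*Y3 + Y1*X2*Y2^2*X3)
        * (X3^2 + Y3^2 + X3^2 * Y3^2 - 1)"
  unfolding assms
  by (simp add: algebra_simps power_numeral_even power_numeral_odd power2_eq_square power3_eq_cube)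

section \<open>Arithmetic modulo \<open>p\<close> and the Edwards addition law\<close>

locale prime_3_mod_4 =
  fixes p :: nat
  assumes prime: "prime p" and p_cong_3: "[p = 3] (mod 4)"
begin

abbreviation cong_p :: "int \<Rightarrow> int \<Rightarrow> bool" (infix "\<doteq>" 50)
  where "a \<doteq> b \<equiv> [a = b] (mod int p)"

text \<open>Working device for the computations: once \<open>a - b\<close> is written with explicit
  cofactors in terms of known congruences, only an identity between integer polynomials is left. The
  cofactors are supplied at each use.\<close>

lemma cong_p_comb:
  assumes "a - b = u * (c - d)" "c \<doteq> d" shows "a \<doteq> b"
  using assms by (simp add: cong_iff_dvd_diff)

lemma cong_p_comb2:
  assumes "a - b = u1 * (c1 - d1) + u2 * (c2 - d2)" "c1 \<doteq> d1" "c2 \<doteq> d2" shows "a \<doteq> b"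
  using assms by (simp add: cong_iff_dvd_diff)

lemma cong_p_comb3:
  assumes "a - b = u1 * (c1 - d1) + u2 * (c2 - d2) + u3 * (c3 - d3)" "c1 \<doteq> d1" "c2 \<doteq> d2" "c3 \<doteq> d3"
  shows "a \<doteq> b"
  using assms by (simp add: cong_iff_dvd_diff)

lemma mult_cong_0_iff: "a * b \<doteq> 0 \<longleftrightarrow> a \<doteq> 0 \<or> b \<doteq> 0"
  using prime by (simp add: cong_0_iff prime_dvd_mult_iff)

lemma cong_p_cancel:
  assumes "c * a \<doteq> c * b" "\<not> c \<doteq> 0" shows "a \<doteq> b"
proof -
  have "c * (a - b) \<doteq> 0"
    using assms(1) by (simp add: cong_iff_dvd_diff algebra_simps)
  then show ?thesis
    using assms(2) by (simp add: mult_cong_0_iff) (simp add: cong_iff_dvd_diff)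
qed

lemma p_gt_2: "2 < p"
  using p_cong_3 unfolding cong_def by presburger

lemma not_2_cong_0: "\<not> 2 \<doteq> 0"
  using p_gt_2 zdvd_not_zless[of 2 "int p"] by (simp add: cong_0_iff)

text \<open>Stands in for the quotient \<open>b / c\<close>.\<close>

lemma solve_linear:
  assumes "\<not> c \<doteq> 0" obtains x where "c * x \<doteq> b"
proof -
  have "coprime c (int p)"
    using assms prime by (metis cong_0_iff coprime_commute prime_imp_coprime prime_nat_int_transfer)
  then obtain d where "c * d \<doteq> 1"
    using cong_solve_coprime_int by blast
  then have "c * (d * b) \<doteq> b"
    using cong_scalar_right[of "c * d" 1 "int p" b] by (simp add: mult.assoc)
  then show ?thesis by (rule that)
qed

lemma QuadRes_uminus: "\<not> a \<doteq> 0 \<Longrightarrow> QuadRes (int p) (- a) \<longleftrightarrow> \<not> QuadRes (int p) a"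
  using QuadRes_uminus_iff[OF prime p_cong_3] by (simp add: cong_0_iff)

text \<open>For \<open>b\<close> nonzero modulo \<open>p\<close>, both \<open>b^2\<close> and
  \<open>- (b^2)\<close> would be residues, although -1 is none.\<close>

lemma sum_squares_cong_0:
  assumes "a^2 + b^2 \<doteq> 0" shows "a \<doteq> 0" "b \<doteq> 0"
proof -
  have *: "a^2 \<doteq> - (b^2)"
    using assms by (simp add: cong_iff_dvd_diff)
  have "QuadRes (int p) (b^2)"
    unfolding QuadRes_def by (rule exI[of _ b]) simp
  moreover have "QuadRes (int p) (- (b^2))"
    using * by (auto simp: QuadRes_def)
  ultimately show b: "b \<doteq> 0"
    using QuadRes_uminus[of "b^2"] by (auto simp: power2_eq_square mult_cong_0_iff)
  have "a^2 \<doteq> 0"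
    by (rule cong_p_comb2[OF _ assms b, where ?u1.0=1 and ?u2.0="- b"]) (simp add: power2_eq_square)
  then show "a \<doteq> 0" by (simp add: power2_eq_square mult_cong_0_iff)
qed

text \<open>The Edwards form \<open>X^2 + Y^2 = 1 + d * X^2 * Y^2\<close> with
  \<open>d = - 1\<close>, a non-residue. Equivalently
  \<open>(1 + X^2) * (1 + Y^2) = 2\<close>.\<close>

definition on_edwards :: "int \<Rightarrow> int \<Rightarrow> bool" where
  "on_edwards X Y \<longleftrightarrow> X^2 + Y^2 + X^2 * Y^2 \<doteq> 1"

text \<open>
  Addition is a relation without division: it determines \<open>(X3, Y3)\<close> modulo \<open>p\<close> only because the
  factors on the left are invertible for points on the curve.
\<close>

definition edwards_sum :: "int \<Rightarrow> int \<Rightarrow> int \<Rightarrow> int \<Rightarrow> int \<Rightarrow> int \<Rightarrow> bool" where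
  "edwards_sum X1 Y1 X2 Y2 X3 Y3 \<longleftrightarrow>
     (1 - X1 * X2 * Y1 * Y2) * X3 \<doteq> X1 * Y2 + X2 * Y1 \<and>
     (1 + X1 * X2 * Y1 * Y2) * Y3 \<doteq> Y1 * Y2 - X1 * X2"

text \<open>
  A vanishing denominator would make two sums of two squares vanish, and \<open>-1\<close> is a non-residue.
\<close>

lemma edwards_complete:
  assumes "on_edwards X1 Y1" "on_edwards X2 Y2"
  shows "\<not> 1 - X1 * X2 * Y1 * Y2 \<doteq> 0" "\<not> 1 + X1 * X2 * Y1 * Y2 \<doteq> 0"
proof -
  let ?t = "X1 * X2 * Y1 * Y2"
  \<comment> \<open>The signs \<open>s = 1\<close> and \<open>s = - 1\<close> stand for the two
    denominators. Since \<open>?t^2\<close> becomes 1, the two curve equations combine into sums of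
    two squares.\<close>
  have *: False if t: "?t \<doteq> s" and s: "s * s = 1" for s
  proof -
    have "(X1 - s * Y1)^2 + (X1 * Y1 * (X2 + Y2))^2 \<doteq> 0"
      by (rule cong_p_comb3[OF _ assms[unfolded on_edwards_def] t, where ?u1.0=1
            and ?u2.0="X1^2 * Y1^2" and ?u3.0="2 * X1 * Y1 - (?t + s)"])
        (use s in Groebner_Basis.algebra)
    then have 1: "X1 * Y1 * (X2 + Y2) \<doteq> 0" by (rule sum_squares_cong_0)
    have "(X1 + s * Y1)^2 + (X1 * Y1 * (X2 - Y2))^2 \<doteq> 0"
      by (rule cong_p_comb3[OF _ assms[unfolded on_edwards_def] t, where ?u1.0=1
            and ?u2.0="X1^2 * Y1^2" and ?u3.0="- 2 * X1 * Y1 - (?t + s)"])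
        (use s in Groebner_Basis.algebra)
    then have 2: "X1 * Y1 * (X2 - Y2) \<doteq> 0" by (rule sum_squares_cong_0)
    \<comment> \<open>Adding the two vanishing terms and multiplying by \<open>Y2\<close> gives
      \<open>2 * ?t\<close>, that is \<open>2 * s\<close>.\<close>
    have "2 * (s * s) \<doteq> 0"
      by (rule cong_p_comb3[OF _ 1 2 t, where ?u1.0="Y2 * s" and ?u2.0="Y2 * s" and ?u3.0="- 2 * s"])
        Groebner_Basis.algebra
    with s not_2_cong_0 show False by simp
  qed
  from *[of 1] show "\<not> 1 - ?t \<doteq> 0" by (auto simp: cong_iff_dvd_diff dvd_diff_commute)
  from *[of "- 1"] show "\<not> 1 + ?t \<doteq> 0" by (auto simp: cong_iff_dvd_diff algebra_simps)
qed

lemma edwards_sum_unique: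
  assumes "on_edwards X1 Y1" "on_edwards X2 Y2"
    and "edwards_sum X1 Y1 X2 Y2 X3 Y3" "edwards_sum X1 Y1 X2 Y2 X3' Y3'"
  shows "X3 \<doteq> X3'" "Y3 \<doteq> Y3'"
proof -
  note S = assms(3,4)[unfolded edwards_sum_def]
  show "X3 \<doteq> X3'"
    by (rule cong_p_cancel[OF cong_trans[OF S(1)[THEN conjunct1] cong_sym[OF S(2)[THEN conjunct1]]]
          edwards_complete(1)[OF assms(1,2)]])
  show "Y3 \<doteq> Y3'"
    by (rule cong_p_cancel[OF cong_trans[OF S(1)[THEN conjunct2] cong_sym[OF S(2)[THEN conjunct2]]]
          edwards_complete(2)[OF assms(1,2)]])
qed

lemma edwards_sum_commute: "edwards_sum X1 Y1 X2 Y2 X3 Y3 \<Longrightarrow> edwards_sum X2 Y2 X1 Y1 X3 Y3"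
  by (simp add: edwards_sum_def mult_ac add.commute)

text \<open>\<open>A\<close> and \<open>B\<close> are the denominators of the two sides after
  clearing the inner ones. They are nonzero by completeness, and
  \<open>edwards_assoc_identity\<close> is the cross-multiplied equality of the two
  fractions.\<close>

lemma edwards_assoc_X:
  assumes E: "on_edwards X1 Y1" "on_edwards X2 Y2" "on_edwards X3 Y3"
    "on_edwards X12 Y12" "on_edwards X23 Y23"
    and D: "(1 - X1 * X2 * Y1 * Y2) * X12 \<doteq> X1 * Y2 + X2 * Y1"
           "(1 + X1 * X2 * Y1 * Y2) * Y12 \<doteq> Y1 * Y2 - X1 * X2"
           "(1 - X2 * X3 * Y2 * Y3) * X23 \<doteq> X2 * Y3 + X3 * Y2"
           "(1 + X2 * X3 * Y2 * Y3) * Y23 \<doteq> Y2 * Y3 - X2 * X3"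
    and L: "(1 - X12 * X3 * Y12 * Y3) * XL \<doteq> X12 * Y3 + X3 * Y12"
    and M: "(1 - X1 * X23 * Y1 * Y23) * XM \<doteq> X1 * Y23 + X23 * Y1"
  shows "XL \<doteq> XM"
proof -
  define N N' M M' where "N = X1 * Y2 + X2 * Y1" and "N' = Y1 * Y2 - X1 * X2"
    and "M = X2 * Y3 + X3 * Y2" and "M' = Y2 * Y3 - X2 * X3"
  define D1 D2 E1 E2 where "D1 = 1 - X1 * X2 * Y1 * Y2" and "D2 = 1 + X1 * X2 * Y1 * Y2"
    and "E1 = 1 - X2 * X3 * Y2 * Y3" and "E2 = 1 + X2 * X3 * Y2 * Y3"
  define A where "A = D1 * D2 - N * N' * X3 * Y3"
  define B where "B = E1 * E2 - M * M' * X1 * Y1"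
  note D' = D[folded N_def N'_def M_def M'_def D1_def D2_def E1_def E2_def]
  have NN: "D1 * D2 * (X12 * Y12) \<doteq> N * N'"
    using cong_mult[OF D'(1,2)] by (simp add: mult_ac)
  have MM: "E1 * E2 * (X23 * Y23) \<doteq> M * M'"
    using cong_mult[OF D'(3,4)] by (simp add: mult_ac)
  have nz: "\<not> D1 \<doteq> 0" "\<not> D2 \<doteq> 0" "\<not> E1 \<doteq> 0" "\<not> E2 \<doteq> 0"
    "\<not> 1 - X12 * X3 * Y12 * Y3 \<doteq> 0" "\<not> 1 - X1 * X23 * Y1 * Y23 \<doteq> 0"
    unfolding D1_def D2_def E1_def E2_def by (intro edwards_complete E)+
  have A1: "A \<doteq> D1 * D2 * (1 - X12 * X3 * Y12 * Y3)"
    by (rule cong_p_comb[OF _ NN, where u="X3 * Y3"]) (simp add: A_def algebra_simps)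
  have B1: "B \<doteq> E1 * E2 * (1 - X1 * X23 * Y1 * Y23)"
    by (rule cong_p_comb[OF _ MM, where u="X1 * Y1"]) (simp add: B_def algebra_simps)
  have A0: "\<not> A \<doteq> 0"
    using nz A1 by (metis cong_sym cong_trans mult_cong_0_iff)
  have B0: "\<not> B \<doteq> 0"
    using nz B1 by (metis cong_sym cong_trans mult_cong_0_iff)
  have AL1: "A * XL \<doteq> D1 * D2 * (X12 * Y3 + X3 * Y12)"
    by (rule cong_p_comb2[OF _ A1 L, where ?u1.0=XL and ?u2.0="D1 * D2"]) Groebner_Basis.algebra
  have AL2: "D1 * D2 * (X12 * Y3 + X3 * Y12) \<doteq> N * Y3 * D2 + X3 * N' * D1"
    by (rule cong_p_comb2[OF _ D'(1,2), where ?u1.0="Y3 * D2" and ?u2.0="X3 * D1"]) Groebner_Basis.algebra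
  note AL = cong_trans[OF AL1 AL2]
  have BM1: "B * XM \<doteq> E1 * E2 * (X1 * Y23 + X23 * Y1)"
    by (rule cong_p_comb2[OF _ B1 assms(11), where ?u1.0=XM and ?u2.0="E1 * E2"]) Groebner_Basis.algebra
  have BM2: "E1 * E2 * (X1 * Y23 + X23 * Y1) \<doteq> X1 * M' * E1 + M * Y1 * E2"
    by (rule cong_p_comb2[OF _ D'(3,4), where ?u1.0="Y1 * E2" and ?u2.0="X1 * E1"]) Groebner_Basis.algebra
  note BM = cong_trans[OF BM1 BM2]
  have id: "A * (X1 * M' * E1 + M * Y1 * E2) \<doteq> B * (N * Y3 * D2 + X3 * N' * D1)"
    using E(1-3) unfolding on_edwards_def A_def B_def D1_def D2_def E1_def E2_def N_def N'_def M_def M'_def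
    by (intro cong_p_comb3[OF edwards_assoc_identity])
  have "(A * B) * XM \<doteq> (A * B) * XL"
    by (rule cong_p_comb3[OF _ BM id AL, where ?u1.0=A and ?u2.0=1 and ?u3.0="- B"]) Groebner_Basis.algebra
  with A0 B0 have "XM \<doteq> XL"
    by (metis cong_p_cancel mult_cong_0_iff)
  then show ?thesis by (rule cong_sym)
qed

text \<open>
  The substitution \<open>(X\<^sub>1, Y\<^sub>1) \<mapsto> (Y\<^sub>1, - X\<^sub>1)\<close>, translation by a point of order four, turns the ordinate of a
  sum into its abscissa, so that the statement about abscissae also covers the ordinates.
\<close>

lemma edwards_assoc:
  assumes E: "on_edwards X1 Y1" "on_edwards X2 Y2" "on_edwards X3 Y3"
    "on_edwards X12 Y12" "on_edwards X23 Y23"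
    and S: "edwards_sum X1 Y1 X2 Y2 X12 Y12" "edwards_sum X2 Y2 X3 Y3 X23 Y23"
    and L: "edwards_sum X12 Y12 X3 Y3 XL YL" and M: "edwards_sum X1 Y1 X23 Y23 XM YM"
  shows "XL \<doteq> XM" "YL \<doteq> YM"
proof -
  note S' = S[unfolded edwards_sum_def] and L' = L[unfolded edwards_sum_def] and M' = M[unfolded edwards_sum_def]
  show "XL \<doteq> XM"
    by (rule edwards_assoc_X[OF E S'(1)[THEN conjunct1] S'(1)[THEN conjunct2]
          S'(2)[THEN conjunct1] S'(2)[THEN conjunct2] L'[THEN conjunct1] M'[THEN conjunct1]])
  have E': "on_edwards Y1 (- X1)" "on_edwards Y12 (- X12)"
    using E(1,4) by (simp_all only: on_edwards_def power2_minus add_ac mult_ac)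
  have S12: "(1 - Y1 * X2 * - X1 * Y2) * Y12 \<doteq> Y1 * Y2 + X2 * - X1"
    by (rule cong_p_comb[OF _ S'(1)[THEN conjunct2], where u=1]) (simp add: algebra_simps)
  have S12': "(1 + Y1 * X2 * - X1 * Y2) * - X12 \<doteq> - X1 * Y2 - Y1 * X2"
    by (rule cong_p_comb[OF _ S'(1)[THEN conjunct1], where u="-1"]) (simp add: algebra_simps)
  have L12: "(1 - Y12 * X3 * - X12 * Y3) * YL \<doteq> Y12 * Y3 + X3 * - X12"
    by (rule cong_p_comb[OF _ L'[THEN conjunct2], where u=1]) (simp add: algebra_simps)
  have M23: "(1 - Y1 * X23 * - X1 * Y23) * YM \<doteq> Y1 * Y23 + X23 * - X1"
    by (rule cong_p_comb[OF _ M'[THEN conjunct2], where u=1]) (simp add: algebra_simps)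
  show "YL \<doteq> YM"
    by (rule edwards_assoc_X[OF E'(1) E(2,3) E'(2) E(5) S12 S12'
          S'(2)[THEN conjunct1] S'(2)[THEN conjunct2] L12 M23])
qed

end

section \<open>Transfer from the Weierstrass model\<close>

text \<open>
  If the line of slope \<open>l\<close> and intercept \<open>n\<close> meets \<open>y\<^sup>2 = x\<^sup>3 + e\<^sup>2 x\<close> at abscissae \<open>x1\<close>, \<open>x2\<close>, \<open>x3\<close>, then
  Vieta's formulas read \<open>l\<^sup>2 = s1\<close>, \<open>n\<^sup>2 = s3\<close>, \<open>2 l n = h\<close>, and \<open>yy\<close> is \<open>2 y1 y2\<close>. Under these relations
  the right-hand sides of the next two identities vanish.
\<close>

lemma collinear_identity_Y:
  fixes x1 x2 x3 e :: int
  defines "s1 \<equiv> x1 + x2 + x3" and "s3 \<equiv> x1 * x2 * x3" and "h \<equiv> e^2 - (x1 * x2 + x1 * x3 + x2 * x3)"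
  defines "yy \<equiv> 2 * s1 * (x1 * x2) + h * (x1 + x2) + 2 * s3"
  shows "(x3 - e) * ((x1 + e) * (x2 + e) * ((x1^2 + e^2) * (x2^2 + e^2)) + e * yy * ((x1 - e) * (x2 - e)))
       - (x3 + e) * ((x1 - e) * (x2 - e) * ((x1^2 + e^2) * (x2^2 + e^2)) - e * yy * ((x1 + e) * (x2 + e)))
     = (- 2 * x1 * x2 * e - 2 * e^3) * (h^2 - 4 * s1 * s3)"
  unfolding assms
  by (simp add: algebra_simps power_numeral_even power_numeral_odd power2_eq_square power3_eq_cube)

lemma collinear_identity_X:
  fixes x1 x2 x3 e l n :: int
  defines "s1 \<equiv> x1 + x2 + x3" and "s3 \<equiv> x1 * x2 * x3" and "h \<equiv> e^2 - (x1 * x2 + x1 * x3 + x2 * x3)"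
  defines "yy \<equiv> 2 * s1 * (x1 * x2) + h * (x1 + x2) + 2 * s3"
  shows "- (l * x3 + n) * ((x1^2 + e^2) * (x2^2 + e^2) * ((x1 + e) * (x2 + e)) - e * yy * ((x1 - e) * (x2 - e)))
       - (x3^2 + e^2) * ((l * x1 + n) * (x2 - e) * ((x2^2 + e^2) * (x1 + e))
           + (l * x2 + n) * (x1 - e) * ((x1^2 + e^2) * (x2 + e)))
     = (x1^2*x2^2*x3 - x1^2*x2*e^2 + x1^2*x3*e^2 - x1^2*e^3 - x1*x2^2*e^2 + 2*x1*x2*e^3 - x1*e^4
          + x2^2*x3*e^2 - x2^2*e^3 - x2*e^4 + x3*e^4) * (2 * s1 * n - l * h)
     + (- (x1^2)*x2^2 - x1^2*x2*x3 - x1^2*x3*e - x1^2*e^2 - x1*x2^2*x3 + 2*x1*x2*x3*e - x1*x3*e^2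
          - x2^2*x3*e - x2^2*e^2 - x2*x3*e^2 - e^4) * (2 * s3 * l - n * h)"
  unfolding assms
  by (simp add: algebra_simps power_numeral_even power_numeral_odd power2_eq_square power3_eq_cube)

text \<open>The condition on \<open>w\<close> puts \<open>(e, w * e)\<close> on the curve. The
  tangent there has slope \<open>w\<close>, so this point doubles to \<open>(0, 0)\<close> and has
  order four; its Edwards coordinates are \<open>(1, 0)\<close>.\<close>

locale split_curve = prime_3_mod_4 +
  fixes m e w :: int
  assumes e_sq: "e^2 \<doteq> - m" and w_sq: "w^2 \<doteq> 2 * e" and e_nz: "\<not> e \<doteq> 0"
begin

lemma w_nz: "\<not> w \<doteq> 0"
proof
  assume w0: "w \<doteq> 0"
  have "2 * e \<doteq> 0"
    by (rule cong_p_comb2[OF _ w_sq w0, where ?u1.0="- 1" and ?u2.0=w]) (simp add: power2_eq_square)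
  then show False using e_nz not_2_cong_0 by (simp add: mult_cong_0_iff)
qed

lemma cong_p_eq: "\<lbrakk>a \<doteq> b; a \<in> {0..<int p}; b \<in> {0..<int p}\<rbrakk> \<Longrightarrow> a = b"
  by (auto simp: cong_less_imp_eq_int)

definition on_curve :: "int \<Rightarrow> int \<Rightarrow> bool" where
  "on_curve x y \<longleftrightarrow> y^2 \<doteq> x^3 + e^2 * x"

lemma c_nz: "\<not> x^2 + e^2 \<doteq> 0"
  using sum_squares_cong_0(2) e_nz by blast

text \<open>At \<open>x = - e\<close> the equation reads
  \<open>y^2 = - 2 * e^3 = - (w * e)^2\<close>, a vanishing sum of two squares.\<close>

lemma a_nz:
  assumes "on_curve x y" shows "\<not> x + e \<doteq> 0"
proof
  assume a: "x + e \<doteq> 0"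
  have "y^2 + (w * e)^2 \<doteq> 0"
    by (rule cong_p_comb3[OF _ assms[unfolded on_curve_def] w_sq a, where ?u1.0=1 and ?u2.0="e^2"
          and ?u3.0="x^2 - x * e + 2 * e^2"]) Groebner_Basis.algebra
  then show False
    using sum_squares_cong_0(2) e_nz w_nz mult_cong_0_iff by blast
qed

text \<open>
  The map \<open>(x, y) \<mapsto> (w x / y, (x - e) / (x + e))\<close> of the Montgomery model to the Edwards model, with
  \<open>x / y\<close> rewritten as \<open>y / (x\<^sup>2 + e\<^sup>2)\<close> so that \<open>(0, 0)\<close> is no exception.
\<close>

fun edwards_coords :: "int ec_point \<Rightarrow> int \<Rightarrow> int \<Rightarrow> bool" where
  "edwards_coords Infinity X Y \<longleftrightarrow> X \<doteq> 0 \<and> Y \<doteq> 1"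
| "edwards_coords (Point x y) X Y \<longleftrightarrow> (x^2 + e^2) * X \<doteq> w * y \<and> (x + e) * Y \<doteq> x - e"

section \<open>The chord-and-tangent law as congruences\<close>

lemma carrier_res: "carrier (residue_ring (int p)) = {0..<int p}"
  by (auto simp: residue_ring_def)

interpretation R: residues_prime p "residue_ring (int p)"
  by unfold_locales (simp_all add: prime)

lemma res_pow_eq: "x \<in> {0..<int p} \<Longrightarrow> x [^]\<^bsub>residue_ring (int p)\<^esub> (n::nat) = x ^ n mod int p"
  using R.pow_cong[of x n] by simp

lemma carrier_E_group:
  "carrier (E_group p m) =
     insert Infinity {Point x y | x y. x \<in> {0..<int p} \<and> y \<in> {0..<int p} \<and> on_curve x y}"
proof -
  have "(y^2 mod int p = ((x^3 mod int p + ((- m) mod int p * x) mod int p) mod int p + 0) mod int p)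
      \<longleftrightarrow> on_curve x y" for x y
  proof -
    have "x^3 + e^2 * x \<doteq> x^3 + (- m) * x"
      by (rule cong_p_comb[OF _ e_sq, where u=x]) (simp add: algebra_simps)
    then show ?thesis
      unfolding on_curve_def by (simp add: cong_def mod_simps)
  qed
  then show ?thesis
    unfolding E_group_def ec_group_def ec_points_def
    by (auto simp: carrier_res res_pow_eq R.res_add_eq R.res_mult_eq R.res_zero_eq)
qed

lemma mult_E_group: "monoid.mult (E_group p m) = ec_add (residue_ring (int p)) ((- m) mod int p)"
  by (simp add: E_group_def ec_group_def)

lemma one_E_group: "one (E_group p m) = Infinity"
  by (simp add: E_group_def ec_group_def)

lemma ec_chord_eq:
  assumes "l \<in> {0..<int p}"
  shows "ec_chord (residue_ring (int p)) l x1 y1 x2 =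
    (let x3 = (l^2 - x1 - x2) mod int p in Point x3 ((l * (x1 - x3) - y1) mod int p))"
  using assms by (simp add: ec_chord_def Let_def res_pow_eq a_minus_def R.res_add_eq R.res_mult_eq R.res_neg_eq mod_simps)

lemma res_inv:
  assumes "u \<in> {0..<int p}" "\<not> u \<doteq> 0"
  shows "u * (inv\<^bsub>residue_ring (int p)\<^esub> u) \<doteq> 1"
proof -
  have "u \<in> Units (residue_ring (int p))"
    using assms by (auto simp: R.field_Units R.res_zero_eq carrier_res)
  then have "u \<otimes>\<^bsub>residue_ring (int p)\<^esub> inv\<^bsub>residue_ring (int p)\<^esub> u = \<one>\<^bsub>residue_ring (int p)\<^esub>"
    by (rule R.Units_r_inv)
  then show ?thesis
    using p_gt_2 by (simp add: R.res_mult_eq R.res_one_eq cong_def)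
qed

text \<open>Treats chord and tangent uniformly. The last two relations hold in both cases: for a
  chord the second defines \<open>l\<close>, for a tangent the first does and the second is
  trivial.\<close>

lemma ec_add_chord:
  assumes P: "Point x1 y1 \<in> carrier (E_group p m)" and Q: "Point x2 y2 \<in> carrier (E_group p m)"
    and ne: "\<not> (x1 = x2 \<and> y1 \<doteq> - y2)"
  obtains l x3 y3 where "Point x1 y1 \<otimes>\<^bsub>E_group p m\<^esub> Point x2 y2 = Point x3 y3"
    "x3 \<in> {0..<int p}" "y3 \<in> {0..<int p}"
    "x3 \<doteq> l^2 - x1 - x2" "y3 \<doteq> l * (x1 - x3) - y1"
    "l * (y1 + y2) \<doteq> x1^2 + x1 * x2 + x2^2 + e^2" "y2 - y1 \<doteq> l * (x2 - x1)"
proof -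
  let ?R = "residue_ring (int p)"
  have in_p: "x1 \<in> {0..<int p}" "y1 \<in> {0..<int p}" "x2 \<in> {0..<int p}" "y2 \<in> {0..<int p}"
    and C: "on_curve x1 y1" "on_curve x2 y2"
    using P Q by (auto simp: carrier_E_group)
  note C' = C[unfolded on_curve_def]
  have mod_p: "a mod int p \<in> {0..<int p}" for a using p_gt_2 by simp
  have neg_eq: "y1 = \<ominus>\<^bsub>?R\<^esub> y2 \<longleftrightarrow> y1 \<doteq> - y2"
    using in_p by (simp add: R.res_neg_eq cong_def)
  note result = that
  have *: thesis if l: "l \<in> {0..<int p}"
    and eq: "Point x1 y1 \<otimes>\<^bsub>E_group p m\<^esub> Point x2 y2 = ec_chord ?R l x1 y1 x2"
    and 1: "l * (y1 + y2) \<doteq> x1^2 + x1 * x2 + x2^2 + e^2" and 2: "y2 - y1 \<doteq> l * (x2 - x1)" for l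
  proof (rule result)
    show "Point x1 y1 \<otimes>\<^bsub>E_group p m\<^esub> Point x2 y2 =
        Point ((l^2 - x1 - x2) mod int p) ((l * (x1 - (l^2 - x1 - x2) mod int p) - y1) mod int p)"
      using l by (simp only: eq ec_chord_eq Let_def)
  qed (use 1 2 mod_p in \<open>simp_all only: cong_mod_left cong_refl\<close>)
  show thesis
  proof (cases "x1 = x2")
    case True
    have "(y1 - y2) * (y1 + y2) \<doteq> 0"
      by (rule cong_p_comb2[OF _ C', where ?u1.0=1 and ?u2.0="- 1"])
        (simp add: True algebra_simps power2_eq_square)
    moreover have "\<not> y1 + y2 \<doteq> 0"
      using ne True by (simp add: cong_iff_dvd_diff)
    ultimately have "y1 - y2 \<doteq> 0" by (simp add: mult_cong_0_iff)
    then have y: "y1 = y2"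
      using in_p by (intro cong_p_eq) (auto simp: cong_iff_dvd_diff)
    define u where "u = y1 \<oplus>\<^bsub>?R\<^esub> y1"
    define k where "k = x1 [^]\<^bsub>?R\<^esub> (2::nat) \<oplus>\<^bsub>?R\<^esub> x1 [^]\<^bsub>?R\<^esub> (2::nat) \<oplus>\<^bsub>?R\<^esub> x1 [^]\<^bsub>?R\<^esub> (2::nat) \<oplus>\<^bsub>?R\<^esub> (- m) mod int p"
    define l where "l = k \<otimes>\<^bsub>?R\<^esub> inv\<^bsub>?R\<^esub> u"
    have u: "u \<doteq> y1 + y2" by (simp add: u_def R.res_add_eq y)
    have u0: "u \<in> {0..<int p}" unfolding u_def R.res_add_eq by (rule mod_p)
    have "\<not> u \<doteq> 0" using \<open>\<not> y1 + y2 \<doteq> 0\<close> u by (metis cong_sym cong_trans)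
    note inv_u = res_inv[OF u0 this]
    have k1: "k \<doteq> x1^2 + x1^2 + x1^2 + - m"
      using in_p by (simp add: k_def res_pow_eq R.res_add_eq mod_simps cong_def)
    have k: "k \<doteq> x1^2 + x1 * x2 + x2^2 + e^2"
      by (rule cong_p_comb2[OF _ k1 e_sq, where ?u1.0=1 and ?u2.0="- 1"]) (simp add: True power2_eq_square)
    have l1: "l \<doteq> k * inv\<^bsub>?R\<^esub> u" by (simp add: l_def R.res_mult_eq)
    have lu: "l * u \<doteq> k"
      by (rule cong_p_comb2[OF _ l1 inv_u, where ?u1.0=u and ?u2.0=k]) (simp add: algebra_simps)
    have "l * (y1 + y2) \<doteq> x1^2 + x1 * x2 + x2^2 + e^2"
      by (rule cong_p_comb3[OF _ lu u k, where ?u1.0=1 and ?u2.0="- l" and ?u3.0=1]) (simp add: algebra_simps)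
    moreover have "l \<in> {0..<int p}" unfolding l_def R.res_mult_eq by (rule mod_p)
    moreover have "Point x1 y1 \<otimes>\<^bsub>E_group p m\<^esub> Point x2 y2 = ec_chord ?R l x1 y1 x2"
      unfolding l_def k_def u_def using True ne neg_eq by (simp add: mult_E_group)
    ultimately show thesis using * True y by simp
  next
    case False
    define u where "u = x2 \<ominus>\<^bsub>?R\<^esub> x1"
    define l where "l = (y2 \<ominus>\<^bsub>?R\<^esub> y1) \<otimes>\<^bsub>?R\<^esub> inv\<^bsub>?R\<^esub> u"
    have x21: "\<not> x2 - x1 \<doteq> 0"
      using False in_p cong_p_eq[of x2 x1] by (auto simp: cong_iff_dvd_diff)
    have u: "u \<doteq> x2 - x1" by (simp add: u_def a_minus_def R.res_add_eq R.res_neg_eq mod_simps)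
    have u0: "u \<in> {0..<int p}" unfolding u_def a_minus_def R.res_add_eq by (rule mod_p)
    have "\<not> u \<doteq> 0" using x21 u by (metis cong_sym cong_trans)
    note inv_u = res_inv[OF u0 this]
    have l1: "l \<doteq> (y2 - y1) * inv\<^bsub>?R\<^esub> u"
      by (simp add: l_def a_minus_def R.res_mult_eq R.res_add_eq R.res_neg_eq mod_simps cong_def)
    have 2: "y2 - y1 \<doteq> l * (x2 - x1)"
      by (rule cong_p_comb3[OF _ l1 inv_u u, where ?u1.0="- u" and ?u2.0="- (y2 - y1)" and ?u3.0="l"])
        (simp add: algebra_simps)
    \<comment> \<open>The difference of the two curve equations has the factor
      \<open>x2 - x1\<close>, which is then cancelled.\<close>
    have "(x2 - x1) * (l * (y1 + y2)) \<doteq> (x2 - x1) * (x1^2 + x1 * x2 + x2^2 + e^2)"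
      by (rule cong_p_comb3[OF _ C' 2, where ?u1.0="- 1" and ?u2.0=1 and ?u3.0="- (y1 + y2)"])
        Groebner_Basis.algebra
    then have 1: "l * (y1 + y2) \<doteq> x1^2 + x1 * x2 + x2^2 + e^2"
      using x21 by (rule cong_p_cancel)
    have "Point x1 y1 \<otimes>\<^bsub>E_group p m\<^esub> Point x2 y2 = ec_chord ?R l x1 y1 x2"
      unfolding l_def u_def using False by (simp add: mult_E_group)
    moreover have "l \<in> {0..<int p}" unfolding l_def R.res_mult_eq by (rule mod_p)
    ultimately show thesis using * 1 2 by simp
  qed
qed

text \<open>Compares the coefficients of \<open>x^3 + e^2 * x - (l * x + n)^2\<close> with those of
  the cubic with roots \<open>x1\<close>, \<open>x2\<close>, \<open>x3\<close>. The double root of a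
  tangent needs no separate treatment, as both slope relations are available.\<close>

lemma chord_vieta:
  assumes C: "on_curve x1 y1"
    and x3: "x3 \<doteq> l^2 - x1 - x2"
    and L: "l * (y1 + y2) \<doteq> x1^2 + x1 * x2 + x2^2 + e^2" and S: "y2 - y1 \<doteq> l * (x2 - x1)"
    and n: "n = y1 - l * x1"
  shows "l^2 \<doteq> x1 + x2 + x3" "2 * (l * n) \<doteq> e^2 - (x1 * x2 + x1 * x3 + x2 * x3)" "n^2 \<doteq> x1 * x2 * x3"
proof -
  show 0: "l^2 \<doteq> x1 + x2 + x3"
    by (rule cong_p_comb[OF _ x3, where u="- 1"]) simp
  show 1: "2 * (l * n) \<doteq> e^2 - (x1 * x2 + x1 * x3 + x2 * x3)"
    by (rule cong_p_comb3[OF _ L S 0, where ?u1.0=1 and ?u2.0="- l" and ?u3.0="- (x1 + x2)"])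
      (simp add: n algebra_simps power2_eq_square)
  show "n^2 \<doteq> x1 * x2 * x3"
    by (rule cong_p_comb3[OF _ C[unfolded on_curve_def] 1 0, where ?u1.0=1 and ?u2.0="- x1" and ?u3.0="- (x1^2)"])
      (simp add: n algebra_simps power2_eq_square power3_eq_cube)
qed

lemma chord_on_curve:
  assumes V: "l^2 \<doteq> x1 + x2 + x3" "2 * (l * n) \<doteq> e^2 - (x1 * x2 + x1 * x3 + x2 * x3)" "n^2 \<doteq> x1 * x2 * x3"
    and y3: "y3 \<doteq> - (l * x3 + n)"
  shows "on_curve x3 y3"
proof -
  have 1: "(l * x3 + n)^2 \<doteq> x3^3 + e^2 * x3"
    by (rule cong_p_comb3[OF _ V, where ?u1.0="x3^2" and ?u2.0=x3 and ?u3.0=1])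
      (simp add: algebra_simps power2_eq_square power3_eq_cube)
  show ?thesis unfolding on_curve_def
    by (rule cong_p_comb2[OF _ y3 1, where ?u1.0="y3 - (l * x3 + n)" and ?u2.0=1])
      (simp add: algebra_simps power2_eq_square)
qed

text \<open>Here \<open>1 + X^2 = ?a^2 / ?c\<close> and \<open>1 + Y^2 = 2 * ?c / ?a^2\<close>, so
  the product is 2. The proof clears the denominator \<open>?c^2 * ?a^2\<close>.\<close>

lemma coords_on_edwards:
  assumes C: "on_curve x y" and X: "(x^2 + e^2) * X \<doteq> w * y" and Y: "(x + e) * Y \<doteq> x - e"
  shows "on_edwards X Y"
proof -
  let ?c = "x^2 + e^2" let ?a = "x + e" let ?b = "x - e"
  have cX: "?c^2 * X^2 \<doteq> 2 * e * x * ?c"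
    by (rule cong_p_comb3[OF _ X w_sq C[unfolded on_curve_def], where ?u1.0="?c * X + w * y" and ?u2.0="y^2" and ?u3.0="2 * e"])
      (simp add: algebra_simps power2_eq_square power3_eq_cube)
  have aY: "?a^2 * Y^2 \<doteq> ?b^2"
    by (rule cong_p_comb[OF _ Y, where u="?a * Y + ?b"]) (simp add: algebra_simps power2_eq_square)
  have "(?c^2 * ?a^2) * (X^2 + Y^2 + X^2 * Y^2) \<doteq> (?c^2 * ?a^2) * 1"
    by (rule cong_p_comb2[OF _ cX aY, where ?u1.0="?a^2 + ?a^2 * Y^2" and ?u2.0="2 * e * x * ?c + ?c^2"])
      (simp add: algebra_simps power2_eq_square)
  moreover have "\<not> ?c^2 * ?a^2 \<doteq> 0"
    using c_nz a_nz[OF C] by (simp add: power2_eq_square mult_cong_0_iff)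
  ultimately show ?thesis unfolding on_edwards_def by (rule cong_p_cancel)
qed

text \<open>Multiplying by the nonzero factors \<open>a1\<close>, \<open>a2\<close>,
  \<open>a3\<close>, \<open>c1\<close>, \<open>c2\<close>, \<open>c3\<close> removes all
  denominators; the two halves then come from \<open>collinear_identity_Y\<close> and
  \<open>collinear_identity_X\<close>.\<close>

lemma chord_edwards_sum:
  assumes C: "on_curve x1 y1" "on_curve x2 y2" "on_curve x3 y3"
    and V: "l^2 \<doteq> x1 + x2 + x3" "2 * (l * n) \<doteq> e^2 - (x1 * x2 + x1 * x3 + x2 * x3)" "n^2 \<doteq> x1 * x2 * x3"
    and y: "y1 \<doteq> l * x1 + n" "y2 \<doteq> l * x2 + n" "y3 \<doteq> - (l * x3 + n)"
    and X: "(x1^2 + e^2) * X1 \<doteq> w * y1" "(x2^2 + e^2) * X2 \<doteq> w * y2" "(x3^2 + e^2) * X3 \<doteq> w * y3"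
    and Y: "(x1 + e) * Y1 \<doteq> x1 - e" "(x2 + e) * Y2 \<doteq> x2 - e" "(x3 + e) * Y3 \<doteq> x3 - e"
  shows "edwards_sum X1 Y1 X2 Y2 X3 Y3"
proof -
  define s1 s3 h where "s1 = x1 + x2 + x3" and "s3 = x1 * x2 * x3"
    and "h = e^2 - (x1 * x2 + x1 * x3 + x2 * x3)"
  define yy where "yy = 2 * s1 * (x1 * x2) + h * (x1 + x2) + 2 * s3"
  define a1 a2 a3 b1 b2 b3 c1 c2 c3 where "a1 = x1 + e" and "a2 = x2 + e" and "a3 = x3 + e"
    and "b1 = x1 - e" and "b2 = x2 - e" and "b3 = x3 - e"
    and "c1 = x1^2 + e^2" and "c2 = x2^2 + e^2" and "c3 = x3^2 + e^2"
  note abc = a1_def a2_def a3_def b1_def b2_def b3_def c1_def c2_def c3_def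
  note V' = V[folded s1_def s3_def h_def]
  note X' = X[folded abc] and Y' = Y[folded abc]
  have nz: "\<not> a1 \<doteq> 0" "\<not> a2 \<doteq> 0" "\<not> a3 \<doteq> 0" "\<not> c1 \<doteq> 0" "\<not> c2 \<doteq> 0" "\<not> c3 \<doteq> 0"
    unfolding abc using C by (simp_all only: a_nz c_nz not_False_eq_True)
  \<comment> \<open>Eliminates \<open>l\<close> and \<open>n\<close>: the square of
    \<open>2 * (l * n)\<close> is four times \<open>l^2 * n^2\<close>.\<close>
  have G: "h^2 \<doteq> 4 * s1 * s3"
    by (rule cong_p_comb3[OF _ V', where ?u1.0="4 * n^2" and ?u2.0="- (2 * (l * n) + h)" and ?u3.0="4 * s1"])
      (simp add: algebra_simps power2_eq_square)
  have yy0: "2 * ((l * x1 + n) * (l * x2 + n)) \<doteq> yy"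
    by (rule cong_p_comb3[OF _ V', where ?u1.0="2 * x1 * x2" and ?u2.0="x1 + x2" and ?u3.0=2])
      (simp add: yy_def algebra_simps power2_eq_square)
  have yy: "2 * (y1 * y2) \<doteq> yy"
    by (rule cong_p_comb3[OF _ y(1,2) yy0, where ?u1.0="2 * y2" and ?u2.0="2 * (l * x1 + n)" and ?u3.0=1])
      (simp add: algebra_simps)
  have I1: "b3 * (a1 * a2 * (c1 * c2) + e * yy * (b1 * b2)) \<doteq> a3 * (b1 * b2 * (c1 * c2) - e * yy * (a1 * a2))"
    by (rule cong_p_comb[OF _ G]) (unfold abc yy_def s1_def s3_def h_def, rule collinear_identity_Y)
  \<comment> \<open>Two evaluations of \<open>2 * l^2 * n\<close>; \<open>W2\<close> likewise
    evaluates \<open>2 * l * n^2\<close> twice.\<close>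
  have W1: "2 * s1 * n \<doteq> l * h"
    by (rule cong_p_comb2[OF _ V'(1,2), where ?u1.0="- 2 * n" and ?u2.0=l]) (simp add: algebra_simps power2_eq_square)
  have W2: "2 * s3 * l \<doteq> n * h"
    by (rule cong_p_comb2[OF _ V'(3,2), where ?u1.0="- 2 * l" and ?u2.0=n]) (simp add: algebra_simps power2_eq_square)
  have "- (l * x3 + n) * (c1 * c2 * (a1 * a2) - e * yy * (b1 * b2))
      \<doteq> c3 * ((l * x1 + n) * b2 * (c2 * a1) + (l * x2 + n) * b1 * (c1 * a2))"
    by (rule cong_p_comb2[OF _ W1 W2]) (unfold abc yy_def s1_def s3_def h_def, rule collinear_identity_X)
  note I2 = cong_p_comb3[OF _ y(3) this y(1)]
  have I2': "y3 * (c1 * c2 * (a1 * a2) - e * yy * (b1 * b2))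
      \<doteq> c3 * (y1 * b2 * (c2 * a1) + (l * x2 + n) * b1 * (c1 * a2))"
    by (rule I2[where ?u1.0="c1 * c2 * (a1 * a2) - e * yy * (b1 * b2)" and ?u2.0=1 and ?u3.0="- c3 * (b2 * (c2 * a1))"])
      (simp add: algebra_simps)
  have I2: "y3 * (c1 * c2 * (a1 * a2) - e * yy * (b1 * b2)) \<doteq> c3 * (y1 * b2 * (c2 * a1) + y2 * b1 * (c1 * a2))"
    by (rule cong_p_comb2[OF _ I2' y(2), where ?u1.0=1 and ?u2.0="- c3 * (b1 * (c1 * a2))"])
      (simp add: algebra_simps)
  have U0: "c1 * c2 * (X1 * X2) \<doteq> w^2 * (y1 * y2)"
    by (rule cong_p_comb2[OF _ X'(1,2), where ?u1.0="c2 * X2" and ?u2.0="w * y1"])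
      (simp add: algebra_simps power2_eq_square)
  \<comment> \<open>The product contains \<open>w\<close> squared, so \<open>w^2 = 2 * e\<close>
    removes it and leaves \<open>2 * (y1 * y2)\<close>, which is \<open>yy\<close>.\<close>
  have U: "c1 * c2 * (X1 * X2) \<doteq> e * yy"
    by (rule cong_p_comb3[OF _ U0 w_sq yy, where ?u1.0=1 and ?u2.0="y1 * y2" and ?u3.0=e])
      (simp add: algebra_simps)
  have V: "a1 * a2 * (Y1 * Y2) \<doteq> b1 * b2"
    by (rule cong_p_comb2[OF _ Y'(1,2), where ?u1.0="a2 * Y2" and ?u2.0="b1"])
      (simp add: algebra_simps)
  let ?t = "X1 * X2 * Y1 * Y2"
  have T: "a1 * a2 * (c1 * c2) * ?t \<doteq> e * yy * (b1 * b2)"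
    using cong_mult[OF U V] by (simp add: mult_ac)
  have "a1 * a2 * (c1 * c2) * a3 * ((1 + ?t) * Y3) \<doteq> b3 * (a1 * a2 * (c1 * c2) + e * yy * (b1 * b2))"
    by (rule cong_p_comb2[OF _ Y'(3) T, where ?u1.0="a1 * a2 * (c1 * c2) * (1 + ?t)" and ?u2.0=b3])
      (simp add: algebra_simps)
  moreover have "a1 * a2 * (c1 * c2) * a3 * (Y1 * Y2 - X1 * X2) \<doteq> a3 * (b1 * b2 * (c1 * c2) - e * yy * (a1 * a2))"
    by (rule cong_p_comb2[OF _ U V, where ?u1.0="- (a1 * a2 * a3)" and ?u2.0="c1 * c2 * a3"])
      (simp add: algebra_simps)
  ultimately have "a1 * a2 * (c1 * c2) * a3 * ((1 + ?t) * Y3) \<doteq> a1 * a2 * (c1 * c2) * a3 * (Y1 * Y2 - X1 * X2)"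
    using I1 by (metis cong_sym cong_trans)
  moreover have "\<not> a1 * a2 * (c1 * c2) * a3 \<doteq> 0" "\<not> a1 * a2 * (c1 * c2) * c3 \<doteq> 0"
    using nz by (simp_all add: mult_cong_0_iff)
  ultimately have Y3: "(1 + ?t) * Y3 \<doteq> Y1 * Y2 - X1 * X2"
    by (auto intro: cong_p_cancel)
  have L1: "a1 * a2 * (c1 * c2) * c3 * ((1 - ?t) * X3) \<doteq> w * (y3 * (c1 * c2 * (a1 * a2) - e * yy * (b1 * b2)))"
    by (rule cong_p_comb2[OF _ X'(3) T, where ?u1.0="a1 * a2 * (c1 * c2) * (1 - ?t)" and ?u2.0="- w * y3"])
      (simp add: algebra_simps)
  have L2: "c1 * X1 * (a2 * Y2) \<doteq> w * y1 * b2" "c2 * X2 * (a1 * Y1) \<doteq> w * y2 * b1"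
    using X' Y' by (auto intro: cong_mult)
  have L3: "a1 * a2 * (c1 * c2) * c3 * (X1 * Y2 + X2 * Y1) \<doteq> w * (c3 * (y1 * b2 * (c2 * a1) + y2 * b1 * (c1 * a2)))"
    by (rule cong_p_comb2[OF _ L2, where ?u1.0="c3 * (c2 * a1)" and ?u2.0="c3 * (c1 * a2)"])
      (simp add: algebra_simps)
  have L4: "a1 * a2 * (c1 * c2) * c3 * ((1 - ?t) * X3) \<doteq> a1 * a2 * (c1 * c2) * c3 * (X1 * Y2 + X2 * Y1)"
    by (rule cong_p_comb3[OF _ L1 I2 L3, where ?u1.0=1 and ?u2.0=w and ?u3.0="- 1"]) (simp add: algebra_simps)
  have "(1 - ?t) * X3 \<doteq> X1 * Y2 + X2 * Y1"
    by (rule cong_p_cancel[OF L4]) fact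
  with Y3 show ?thesis by (simp add: edwards_sum_def)
qed

section \<open>The group and its order\<close>

lemma edwards_coords_exist:
  assumes "P \<in> carrier (E_group p m)" obtains X Y where "edwards_coords P X Y"
proof (cases P)
  case Infinity
  then show ?thesis using that[of 0 1] by simp
next
  case (Point x y)
  with assms have "on_curve x y" by (simp add: carrier_E_group)
  then obtain X Y where "(x^2 + e^2) * X \<doteq> w * y" "(x + e) * Y \<doteq> x - e"
    using solve_linear[OF c_nz] solve_linear[OF a_nz] by metis
  then show ?thesis using that Point by simp
qed

lemma edwards_coords_on_edwards:
  assumes "P \<in> carrier (E_group p m)" "edwards_coords P X Y" shows "on_edwards X Y"
proof (cases P)
  case Infinity
  then have "X \<doteq> 0" "Y \<doteq> 1" using assms(2) by auto
  then show ?thesis unfolding on_edwards_def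
    by (rule cong_p_comb2[rotated, where ?u1.0="X * (1 + Y^2)" and ?u2.0="Y + 1"])
      (simp add: algebra_simps power2_eq_square)
next
  case (Point x y)
  then show ?thesis using assms coords_on_edwards by (auto simp: carrier_E_group)
qed

text \<open>Keeps affine points apart from \<open>Infinity\<close>: \<open>x - e = x + e\<close>
  would force \<open>2 * e = 0\<close>.\<close>

lemma edwards_Y_eq_1:
  assumes "edwards_coords (Point x y) X Y" shows "\<not> Y \<doteq> 1"
proof
  assume Y: "Y \<doteq> 1"
  have XY: "(x + e) * Y \<doteq> x - e" using assms by simp
  have "2 * e \<doteq> 0"
    by (rule cong_p_comb2[OF _ XY Y, where ?u1.0=1 and ?u2.0="- (x + e)"]) (simp add: algebra_simps)
  then show False using not_2_cong_0 e_nz by (simp add: mult_cong_0_iff)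
qed

text \<open>\<open>Y\<close> is a fractional linear function of \<open>x\<close> and so determines
  it; with \<open>x\<close> known, \<open>X\<close> determines \<open>y\<close> because
  \<open>w\<close> is invertible.\<close>

lemma edwards_coords_inj:
  assumes P: "P \<in> carrier (E_group p m)" "edwards_coords P X Y"
    and P': "P' \<in> carrier (E_group p m)" "edwards_coords P' X' Y'"
    and X: "X \<doteq> X'" and Y: "Y \<doteq> Y'"
  shows "P = P'"
proof (cases "Y \<doteq> 1")
  case True
  then have "Y' \<doteq> 1" using Y by (metis cong_sym cong_trans)
  with True show ?thesis
    using P(2) P'(2) edwards_Y_eq_1 by (metis ec_point.exhaust)
next
  case False
  then have "\<not> Y' \<doteq> 1" using Y by (metis cong_trans)
  then obtain x y x' y' where [simp]: "P = Point x y" "P' = Point x' y'"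
    using False P(2) P'(2) by (cases P; cases P') auto
  have range: "x \<in> {0..<int p}" "y \<in> {0..<int p}" "x' \<in> {0..<int p}" "y' \<in> {0..<int p}"
    using P(1) P'(1) by (auto simp: carrier_E_group)
  have c: "(x^2 + e^2) * X \<doteq> w * y" "(x + e) * Y \<doteq> x - e"
    "(x'^2 + e^2) * X' \<doteq> w * y'" "(x' + e) * Y' \<doteq> x' - e"
    using P(2) P'(2) by simp_all
  have "(Y - 1) * (x - x') \<doteq> 0"
    by (rule cong_p_comb3[OF _ c(2,4) Y, where ?u1.0=1 and ?u2.0="- 1" and ?u3.0="- (x' + e)"])
      (simp add: algebra_simps)
  then have "x - x' \<doteq> 0"
    using False by (simp add: mult_cong_0_iff) (simp add: cong_iff_dvd_diff)
  then have x: "x = x'" using range by (intro cong_p_eq) (simp_all add: cong_iff_dvd_diff)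
  have "w * y \<doteq> w * y'"
    by (rule cong_p_comb3[OF _ c(1,3) X, where ?u1.0="- 1" and ?u2.0="1" and ?u3.0="x^2 + e^2"])
      (simp add: x algebra_simps)
  then have "y \<doteq> y'" using w_nz by (rule cong_p_cancel)
  then show ?thesis using x range cong_p_eq by simp
qed

lemma edwards_sum_zero:
  assumes "X1 \<doteq> 0" "Y1 \<doteq> 1" "X3 \<doteq> X2" "Y3 \<doteq> Y2" shows "edwards_sum X1 Y1 X2 Y2 X3 Y3"
  unfolding edwards_sum_def
proof
  show "(1 - X1 * X2 * Y1 * Y2) * X3 \<doteq> X1 * Y2 + X2 * Y1"
    by (rule cong_p_comb3[OF _ assms(1-3), where ?u1.0="- X2 * Y1 * Y2 * X3 - Y2" and ?u2.0="- X2" and ?u3.0=1])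
      (simp add: algebra_simps)
  show "(1 + X1 * X2 * Y1 * Y2) * Y3 \<doteq> Y1 * Y2 - X1 * X2"
    by (rule cong_p_comb3[OF _ assms(1,2,4), where ?u1.0="X2 * Y1 * Y2 * Y3 + X2" and ?u2.0="- Y2" and ?u3.0=1])
      (simp add: algebra_simps)
qed

text \<open>Negating a point changes the sign of \<open>X\<close> only. The curve equation turns the
  denominator \<open>1 - X2^2 * Y2^2\<close> into the numerator \<open>Y2^2 + X2^2\<close>, so the
  sum is the neutral element \<open>(0, 1)\<close>.\<close>

lemma edwards_sum_opposite:
  assumes E: "on_edwards X2 Y2" and X: "X1 \<doteq> - X2" and Y: "Y1 \<doteq> Y2" and X3: "X3 \<doteq> 0" and Y3: "Y3 \<doteq> 1"
  shows "edwards_sum X1 Y1 X2 Y2 X3 Y3"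
  unfolding edwards_sum_def
proof
  show "(1 - X1 * X2 * Y1 * Y2) * X3 \<doteq> X1 * Y2 + X2 * Y1"
    by (rule cong_p_comb3[OF _ X Y X3, where ?u1.0="- Y2" and ?u2.0="- X2" and ?u3.0="1 - X1 * X2 * Y1 * Y2"])
      (simp add: algebra_simps)
  have 1: "1 + X1 * X2 * Y1 * Y2 \<doteq> Y1 * Y2 - X1 * X2"
    by (rule cong_p_comb3[OF _ X Y E[unfolded on_edwards_def], where ?u1.0="X2 * (1 + Y1 * Y2)"
          and ?u2.0="- (X2^2 * Y2) - Y2" and ?u3.0="- 1"]) (simp add: algebra_simps power2_eq_square)
  show "(1 + X1 * X2 * Y1 * Y2) * Y3 \<doteq> Y1 * Y2 - X1 * X2"
    by (rule cong_p_comb2[OF _ 1 Y3, where ?u1.0=1 and ?u2.0="1 + X1 * X2 * Y1 * Y2"])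
      (simp add: algebra_simps)
qed

lemma edwards_coords_cong:
  assumes "P \<in> carrier (E_group p m)" "edwards_coords P X Y" "edwards_coords P X' Y'"
  shows "X \<doteq> X'" "Y \<doteq> Y'"
proof -
  have "X \<doteq> X' \<and> Y \<doteq> Y'"
  proof (cases P)
    case Infinity
    then show ?thesis using assms by (auto intro: cong_trans cong_sym)
  next
    case (Point x y)
    then have "on_curve x y"
      and c: "(x^2 + e^2) * X \<doteq> w * y" "(x^2 + e^2) * X' \<doteq> w * y" "(x + e) * Y \<doteq> x - e" "(x + e) * Y' \<doteq> x - e"
      using assms by (auto simp: carrier_E_group)
    then show ?thesis
      using cong_p_cancel[OF cong_trans[OF c(1) cong_sym[OF c(2)]] c_nz]
        cong_p_cancel[OF cong_trans[OF c(3) cong_sym[OF c(4)]]] a_nz by blast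
  qed
  then show "X \<doteq> X'" "Y \<doteq> Y'" by simp_all
qed

lemma add_opposite:
  "y1 \<in> {0..<int p} \<Longrightarrow> y1 \<doteq> - y2 \<Longrightarrow> Point x y1 \<otimes>\<^bsub>E_group p m\<^esub> Point x y2 = Infinity"
  by (simp add: mult_E_group R.res_neg_eq cong_def)

text \<open>Closure and compatibility with the Edwards law rest on the same case distinction, hence
  the joint proof.\<close>

lemma
  assumes P: "P \<in> carrier (E_group p m)" and Q: "Q \<in> carrier (E_group p m)"
  shows ec_add_closed: "P \<otimes>\<^bsub>E_group p m\<^esub> Q \<in> carrier (E_group p m)" (is ?closed)
    and ec_add_edwards: "\<lbrakk>edwards_coords P X1 Y1; edwards_coords Q X2 Y2; edwards_coords (P \<otimes>\<^bsub>E_group p m\<^esub> Q) X3 Y3\<rbrakk>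
      \<Longrightarrow> edwards_sum X1 Y1 X2 Y2 X3 Y3"
proof -
  have "?closed \<and> (edwards_coords P X1 Y1 \<longrightarrow> edwards_coords Q X2 Y2 \<longrightarrow> edwards_coords (P \<otimes>\<^bsub>E_group p m\<^esub> Q) X3 Y3
      \<longrightarrow> edwards_sum X1 Y1 X2 Y2 X3 Y3)"
  proof (cases P)
    case Infinity
    then have PQ: "P \<otimes>\<^bsub>E_group p m\<^esub> Q = Q" by (simp add: mult_E_group)
    show ?thesis
      unfolding PQ
    proof (intro conjI impI Q)
      assume "edwards_coords P X1 Y1" and Q2: "edwards_coords Q X2 Y2" and Q3: "edwards_coords Q X3 Y3"
      with Infinity show "edwards_sum X1 Y1 X2 Y2 X3 Y3"
        using edwards_coords_cong[OF Q Q3 Q2] edwards_sum_zero by simp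
    qed
  next
    case P': (Point x1 y1)
    show ?thesis
    proof (cases Q)
      case Infinity
      then have PQ: "P \<otimes>\<^bsub>E_group p m\<^esub> Q = P" by (simp add: mult_E_group P')
      show ?thesis
        unfolding PQ
      proof (intro conjI impI P)
        assume P1: "edwards_coords P X1 Y1" and "edwards_coords Q X2 Y2" and P3: "edwards_coords P X3 Y3"
        with Infinity show "edwards_sum X1 Y1 X2 Y2 X3 Y3"
          using edwards_coords_cong[OF P P3 P1] edwards_sum_commute[OF edwards_sum_zero] by simp
      qed
    next
      case Q': (Point x2 y2)
      have range: "x1 \<in> {0..<int p}" "y1 \<in> {0..<int p}" "x2 \<in> {0..<int p}" "y2 \<in> {0..<int p}"
        and C: "on_curve x1 y1" "on_curve x2 y2"
        using P Q P' Q' by (auto simp: carrier_E_group)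
      show ?thesis
      proof (cases "x1 = x2 \<and> y1 \<doteq> - y2")
        case True
        then have PQ: "P \<otimes>\<^bsub>E_group p m\<^esub> Q = Infinity"
          using range by (simp add: P' Q' add_opposite)
        have y: "y1 \<doteq> - y2" using True by simp
        show ?thesis
        proof (intro conjI impI)
          assume X1: "edwards_coords P X1 Y1" and X2: "edwards_coords Q X2 Y2"
            and X3: "edwards_coords (P \<otimes>\<^bsub>E_group p m\<^esub> Q) X3 Y3"
          have e1: "(x2^2 + e^2) * X1 \<doteq> w * y1" "(x2 + e) * Y1 \<doteq> x2 - e"
            and e2: "(x2^2 + e^2) * X2 \<doteq> w * y2" "(x2 + e) * Y2 \<doteq> x2 - e"
            using X1 X2 True P' Q' by simp_all
          have "(x2^2 + e^2) * X1 \<doteq> (x2^2 + e^2) * - X2"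
            by (rule cong_p_comb3[OF _ e1(1) y e2(1), where ?u1.0=1 and ?u2.0=w and ?u3.0=1])
              (simp add: algebra_simps)
          then have "X1 \<doteq> - X2" using c_nz by (rule cong_p_cancel)
          moreover have "Y1 \<doteq> Y2"
            by (rule cong_p_cancel[OF cong_trans[OF e1(2) cong_sym[OF e2(2)]] a_nz[OF C(2)]])
          ultimately show "edwards_sum X1 Y1 X2 Y2 X3 Y3"
            using edwards_sum_opposite edwards_coords_on_edwards[OF Q X2] X3 PQ by simp
        qed (simp add: PQ carrier_E_group)
      next
        case False
        obtain l x3 y3 where PQ: "Point x1 y1 \<otimes>\<^bsub>E_group p m\<^esub> Point x2 y2 = Point x3 y3"
          and r3: "x3 \<in> {0..<int p}" "y3 \<in> {0..<int p}"
          and x3: "x3 \<doteq> l^2 - x1 - x2" and y3: "y3 \<doteq> l * (x1 - x3) - y1"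
          and L: "l * (y1 + y2) \<doteq> x1^2 + x1 * x2 + x2^2 + e^2" and S: "y2 - y1 \<doteq> l * (x2 - x1)"
          using ec_add_chord[OF _ _ False] P Q P' Q' by metis
        define n where "n = y1 - l * x1"
        note V = chord_vieta[OF C(1) x3 L S n_def]
        have y1: "y1 \<doteq> l * x1 + n" by (simp add: n_def)
        have y2: "y2 \<doteq> l * x2 + n"
          by (rule cong_p_comb[OF _ S, where u=1]) (simp add: n_def algebra_simps)
        have y3': "y3 \<doteq> - (l * x3 + n)"
          by (rule cong_p_comb[OF _ y3, where u=1]) (simp add: n_def algebra_simps)
        have C3: "on_curve x3 y3" by (rule chord_on_curve[OF V y3'])
        show ?thesis
          unfolding P' Q' PQ
          using C3 r3 chord_edwards_sum[OF C C3 V y1 y2 y3'] by (simp add: carrier_E_group)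
      qed
    qed
  qed
  then show ?closed and "\<lbrakk>edwards_coords P X1 Y1; edwards_coords Q X2 Y2; edwards_coords (P \<otimes>\<^bsub>E_group p m\<^esub> Q) X3 Y3\<rbrakk>
      \<Longrightarrow> edwards_sum X1 Y1 X2 Y2 X3 Y3" by simp_all
qed

text \<open>Commutativity and associativity are pulled back from the Edwards law along the injective
  coordinates.\<close>

lemma comm_group_E: "comm_group (E_group p m)"
proof (rule comm_groupI)
  show "\<one>\<^bsub>E_group p m\<^esub> \<in> carrier (E_group p m)"
    by (simp add: one_E_group carrier_E_group)
next
  fix P Q assume P: "P \<in> carrier (E_group p m)" and Q: "Q \<in> carrier (E_group p m)"
  show PQ: "P \<otimes>\<^bsub>E_group p m\<^esub> Q \<in> carrier (E_group p m)"
    using P Q by (rule ec_add_closed)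
  have QP: "Q \<otimes>\<^bsub>E_group p m\<^esub> P \<in> carrier (E_group p m)"
    using Q P by (rule ec_add_closed)
  obtain X1 Y1 where c1: "edwards_coords P X1 Y1"
    by (rule edwards_coords_exist[OF P])
  obtain X2 Y2 where c2: "edwards_coords Q X2 Y2"
    by (rule edwards_coords_exist[OF Q])
  obtain X3 Y3 where c3: "edwards_coords (P \<otimes>\<^bsub>E_group p m\<^esub> Q) X3 Y3"
    by (rule edwards_coords_exist[OF PQ])
  obtain X4 Y4 where c4: "edwards_coords (Q \<otimes>\<^bsub>E_group p m\<^esub> P) X4 Y4"
    by (rule edwards_coords_exist[OF QP])
  note u = edwards_sum_unique[OF edwards_coords_on_edwards[OF P c1] edwards_coords_on_edwards[OF Q c2]
      ec_add_edwards[OF P Q c1 c2 c3] edwards_sum_commute[OF ec_add_edwards[OF Q P c2 c1 c4]]]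
  show "P \<otimes>\<^bsub>E_group p m\<^esub> Q = Q \<otimes>\<^bsub>E_group p m\<^esub> P"
    by (rule edwards_coords_inj[OF PQ c3 QP c4 u])
next
  fix P Q S
  assume P: "P \<in> carrier (E_group p m)" and Q: "Q \<in> carrier (E_group p m)" and S: "S \<in> carrier (E_group p m)"
  note PQ = ec_add_closed[OF P Q] and QS = ec_add_closed[OF Q S]
  note L = ec_add_closed[OF PQ S] and M = ec_add_closed[OF P QS]
  obtain X1 Y1 where c1: "edwards_coords P X1 Y1"
    by (rule edwards_coords_exist[OF P])
  obtain X2 Y2 where c2: "edwards_coords Q X2 Y2"
    by (rule edwards_coords_exist[OF Q])
  obtain X3 Y3 where c3: "edwards_coords S X3 Y3"
    by (rule edwards_coords_exist[OF S])
  obtain X12 Y12 where d1: "edwards_coords (P \<otimes>\<^bsub>E_group p m\<^esub> Q) X12 Y12"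
    by (rule edwards_coords_exist[OF PQ])
  obtain X23 Y23 where d2: "edwards_coords (Q \<otimes>\<^bsub>E_group p m\<^esub> S) X23 Y23"
    by (rule edwards_coords_exist[OF QS])
  obtain XL YL where f1: "edwards_coords (P \<otimes>\<^bsub>E_group p m\<^esub> Q \<otimes>\<^bsub>E_group p m\<^esub> S) XL YL"
    by (rule edwards_coords_exist[OF L])
  obtain XM YM where f2: "edwards_coords (P \<otimes>\<^bsub>E_group p m\<^esub> (Q \<otimes>\<^bsub>E_group p m\<^esub> S)) XM YM"
    by (rule edwards_coords_exist[OF M])
  note assoc = edwards_assoc[OF edwards_coords_on_edwards[OF P c1] edwards_coords_on_edwards[OF Q c2]
      edwards_coords_on_edwards[OF S c3] edwards_coords_on_edwards[OF PQ d1] edwards_coords_on_edwards[OF QS d2]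
      ec_add_edwards[OF P Q c1 c2 d1] ec_add_edwards[OF Q S c2 c3 d2]
      ec_add_edwards[OF PQ S d1 c3 f1] ec_add_edwards[OF P QS c1 d2 f2]]
  show "P \<otimes>\<^bsub>E_group p m\<^esub> Q \<otimes>\<^bsub>E_group p m\<^esub> S = P \<otimes>\<^bsub>E_group p m\<^esub> (Q \<otimes>\<^bsub>E_group p m\<^esub> S)"
    by (rule edwards_coords_inj[OF L f1 M f2 assoc])
next
  fix P assume P: "P \<in> carrier (E_group p m)"
  show "\<one>\<^bsub>E_group p m\<^esub> \<otimes>\<^bsub>E_group p m\<^esub> P = P"
    by (simp add: one_E_group mult_E_group)
  show "\<exists>Q\<in>carrier (E_group p m). Q \<otimes>\<^bsub>E_group p m\<^esub> P = \<one>\<^bsub>E_group p m\<^esub>"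
  proof (cases P)
    case Infinity
    then show ?thesis using P by (auto simp: one_E_group mult_E_group intro!: bexI[of _ P])
  next
    case (Point x y)
    define y' where "y' = (- y) mod int p"
    have y': "y' \<doteq> - y" "y' \<in> {0..<int p}" using p_gt_2 by (simp_all add: y'_def)
    have C: "y^2 \<doteq> x^3 + e^2 * x" using P Point by (simp add: carrier_E_group on_curve_def)
    have "on_curve x y'" unfolding on_curve_def
      by (rule cong_p_comb2[OF _ C y'(1), where ?u1.0=1 and ?u2.0="y' - y"])
        (simp add: algebra_simps power2_eq_square)
    then have "Point x y' \<in> carrier (E_group p m)"
      using P Point y'(2) by (simp add: carrier_E_group)
    then show ?thesis
      using add_opposite[OF y'(2,1)] Point by (auto simp: one_E_group)
  qed
qed

section \<open>Involutions, doubles and the number of points\<close>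

lemma QuadRes_mod [simp]: "QuadRes (int p) (a mod int p) \<longleftrightarrow> QuadRes (int p) a"
  by (simp add: QuadRes_def cong_mod_right)

lemma x_cong_0_if_y_cong_0:
  assumes "on_curve x y" "y \<doteq> 0" shows "x \<doteq> 0"
proof -
  have "x * (x^2 + e^2) \<doteq> 0"
    by (rule cong_p_comb2[OF _ assms[unfolded on_curve_def], where ?u1.0="- 1" and ?u2.0=y])
      (simp add: algebra_simps power2_eq_square power3_eq_cube)
  then show ?thesis using c_nz by (simp add: mult_cong_0_iff)
qed

lemma involution_E:
  assumes P: "P \<in> carrier (E_group p m)" and "P \<otimes>\<^bsub>E_group p m\<^esub> P = Infinity" and "P \<noteq> Infinity"
  shows "P = Point 0 0"
proof -
  obtain x y where [simp]: "P = Point x y" using assms(3) by (cases P) auto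
  have xy: "x \<in> {0..<int p}" "y \<in> {0..<int p}" "on_curve x y"
    using P by (auto simp: carrier_E_group)
  have "y \<doteq> - y"
    \<comment> \<open>Otherwise \<open>ec_add_chord\<close> would make the double an affine
      point.\<close>
    using assms(2) ec_add_chord[of x y x y] P by (metis \<open>P = Point x y\<close> ec_point.distinct(1))
  then have "2 * y \<doteq> 0" by (simp add: cong_iff_dvd_diff)
  then have "y \<doteq> 0" using not_2_cong_0 by (simp add: mult_cong_0_iff)
  moreover from this have "x \<doteq> 0" using xy(3) x_cong_0_if_y_cong_0 by blast
  ultimately show ?thesis using xy cong_p_eq[of _ 0] by simp
qed

text \<open>The duplication formula: the double of \<open>(u, v)\<close> has abscissa
  \<open>((u^2 - e^2) / (2 * v))^2\<close>.\<close>

lemma QuadRes_abscissa_double: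
  assumes P: "P \<in> carrier (E_group p m)" and "P \<otimes>\<^bsub>E_group p m\<^esub> P = Point x y"
  shows "QuadRes (int p) x"
proof -
  obtain u v where Puv: "P = Point u v" using assms(2) by (cases P) (auto simp: mult_E_group)
  have uv: "v \<in> {0..<int p}" "on_curve u v"
    using P Puv by (auto simp: carrier_E_group)
  have "\<not> v \<doteq> - v" using assms(2) add_opposite[OF uv(1), of v] Puv by auto
  then have v: "\<not> 2 * v \<doteq> 0" by (simp add: cong_iff_dvd_diff)
  obtain l where x: "x \<doteq> l^2 - u - u" and L: "l * (v + v) \<doteq> u^2 + u * u + u^2 + e^2"
    using ec_add_chord[of u v u v] P assms(2) Puv \<open>\<not> v \<doteq> - v\<close> by (metis ec_point.inject)
  have 1: "(2 * v)^2 * x \<doteq> (u^2 - e^2)^2"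
    by (rule cong_p_comb3[OF _ x L uv(2)[unfolded on_curve_def], where ?u1.0="(2 * v)^2"
          and ?u2.0="l * (v + v) + (u^2 + u * u + u^2 + e^2)" and ?u3.0="- 8 * u"])
      (simp add: algebra_simps power2_eq_square power3_eq_cube)
  obtain s where s: "2 * v * s \<doteq> u^2 - e^2" using solve_linear[OF v] .
  have "(2 * v)^2 * s^2 \<doteq> (2 * v)^2 * x"
    by (rule cong_p_comb2[OF _ 1 s, where ?u1.0="- 1" and ?u2.0="2 * v * s + (u^2 - e^2)"])
      (simp add: algebra_simps power2_eq_square)
  moreover have "\<not> (2 * v)^2 \<doteq> 0" using v by (metis mult_cong_0_iff power2_eq_square)
  ultimately show ?thesis unfolding QuadRes_def using cong_p_cancel by blast
qed

text \<open>
  Since \<open>x\<^sup>3 - m x\<close> is odd in \<open>x\<close> and \<open>-1\<close> is a non-residue, exactly one of each pair \<open>\<plusminus>x \<noteq> 0\<close> is the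
  abscissa of a point, and then of two, distinguished by the quadratic character of the ordinate.
\<close>

lemma order_E: "order (E_group p m) = p + 1"
proof -
  define A where "A = {(x, y). x \<in> {1..<int p} \<and> y \<in> {0..<int p} \<and> on_curve x y}"
  \<comment> \<open>A bijection from \<open>A\<close> onto the nonzero residues: a point over
    \<open>z\<close> is kept for a residue ordinate, and one over \<open>- z\<close> is sent to
    \<open>z\<close> for a non-residue ordinate.\<close>
  define f where "f = (\<lambda>(x, y). if QuadRes (int p) y then x else int p - x)"
  have nz: "\<not> x \<doteq> 0" "\<not> y \<doteq> 0" if "(x, y) \<in> A" for x y
  proof -
    show "\<not> x \<doteq> 0" using that cong_p_eq[of x 0] by (auto simp: A_def)
    then show "\<not> y \<doteq> 0" using that x_cong_0_if_y_cong_0 by (auto simp: A_def)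
  qed
  have inj: "inj_on f A"
  proof (rule inj_onI, clarify)
    fix x y x' y' assume P: "(x, y) \<in> A" and P': "(x', y') \<in> A" and eq: "f (x, y) = f (x', y')"
    have fxy: "(if QuadRes (int p) y then x else int p - x) = (if QuadRes (int p) y' then x' else int p - x')"
      using eq by (simp only: f_def prod.case)
    have C: "y^2 \<doteq> x^3 + e^2 * x" "y'^2 \<doteq> x'^3 + e^2 * x'"
      using P P' by (auto simp: A_def on_curve_def)
    show "x = x' \<and> y = y'"
    proof (cases "QuadRes (int p) y = QuadRes (int p) y'")
      case True
      then have x: "x = x'" using fxy by (simp split: if_splits)
      have "(y - y') * (y + y') \<doteq> 0"
        by (rule cong_p_comb2[OF _ C, where ?u1.0=1 and ?u2.0="- 1"])
          (simp add: x algebra_simps power2_eq_square)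
      moreover have "\<not> y + y' \<doteq> 0"
      proof
        assume "y + y' \<doteq> 0"
        then have "y \<doteq> - y'" by (simp add: cong_iff_dvd_diff)
        then have "QuadRes (int p) y \<longleftrightarrow> QuadRes (int p) (- y')"
          by (metis QuadRes_mod cong_def)
        then show False using True QuadRes_uminus[OF nz(2)[OF P']] by simp
      qed
      ultimately have "y - y' \<doteq> 0" by (simp add: mult_cong_0_iff)
      then have "y = y'" using P P' by (intro cong_p_eq) (auto simp: A_def cong_iff_dvd_diff)
      with x show ?thesis by simp
    next
      case False
      then have "x + x' = int p" using fxy by (simp split: if_splits)
      then have x: "x + x' \<doteq> 0" by (simp add: cong_iff_dvd_diff)
      \<comment> \<open>Opposite abscissae give opposite values of the odd cubic.\<close>
      have "y^2 + y'^2 \<doteq> 0"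
        by (rule cong_p_comb3[OF _ C x, where ?u1.0=1 and ?u2.0=1 and ?u3.0="x^2 - x * x' + x'^2 + e^2"])
          (simp add: algebra_simps power2_eq_square power3_eq_cube)
      then show ?thesis using sum_squares_cong_0(1) nz(2)[OF P] by blast
    qed
  qed
  have "f ` A = {1..<int p}"
  proof (intro equalityI subsetI)
    fix z assume "z \<in> f ` A"
    then show "z \<in> {1..<int p}" by (auto simp: A_def f_def)
  next
    fix z assume z: "z \<in> {1..<int p}"
    have "\<not> z \<doteq> 0" using z cong_p_eq[of z 0] by auto
    then have "\<not> z * (z^2 + e^2) \<doteq> 0" using c_nz by (simp add: mult_cong_0_iff)
    \<comment> \<open>The ordinate can be given either character \<open>b\<close>, since exactly one
      of \<open>y\<close> and \<open>- y\<close> is a residue.\<close>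
    have root: "\<exists>y \<in> {0..<int p}. on_curve x y \<and> (QuadRes (int p) y \<longleftrightarrow> b)"
      if x: "x \<in> {1..<int p}" and q: "QuadRes (int p) (x^3 + e^2 * x)" for x b
    proof -
      obtain y where y: "y^2 \<doteq> x^3 + e^2 * x" using q by (auto simp: QuadRes_def)
      have "\<not> x \<doteq> 0" using x cong_p_eq[of x 0] by auto
      then have "\<not> y \<doteq> 0" using y x_cong_0_if_y_cong_0 by (auto simp: on_curve_def)
      then obtain t where t: "t = y \<or> t = - y" "QuadRes (int p) t \<longleftrightarrow> b"
        using QuadRes_uminus by blast
      have "on_curve x (t mod int p)"
        using y t(1) by (auto simp: on_curve_def cong_def mod_simps)
      then show ?thesis
        using t(2) p_gt_2 by (intro bexI[of _ "t mod int p"]) auto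
    qed
    show "z \<in> f ` A"
    proof (cases "QuadRes (int p) (z^3 + e^2 * z)")
      case True
      then obtain y where "y \<in> {0..<int p}" "on_curve z y" "QuadRes (int p) y"
        using root[OF z, of True] by auto
      then show ?thesis
        using z by (intro image_eqI[of _ _ "(z, y)"]) (auto simp: A_def f_def)
    next
      case False
      have "z^3 + e^2 * z = z * (z^2 + e^2)"
        by (simp add: algebra_simps power2_eq_square power3_eq_cube)
      then have q: "QuadRes (int p) (- (z^3 + e^2 * z))"
        using False \<open>\<not> z * (z^2 + e^2) \<doteq> 0\<close> QuadRes_uminus by simp
      have z': "int p - z \<in> {1..<int p}" using z by auto
      have pz: "int p - z \<doteq> - z" by (simp add: cong_iff_dvd_diff)
      have "- (z^3 + e^2 * z) \<doteq> (int p - z)^3 + e^2 * (int p - z)"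
        by (rule cong_p_comb[OF _ pz, where u="- ((int p - z)^2 - (int p - z) * z + z^2 + e^2)"])
          (simp add: algebra_simps power2_eq_square power3_eq_cube)
      then have "QuadRes (int p) ((int p - z)^3 + e^2 * (int p - z))"
        using q unfolding QuadRes_def by (metis cong_trans)
      then obtain y where "y \<in> {0..<int p}" "on_curve (int p - z) y" "\<not> QuadRes (int p) y"
        using root[OF z', of False] by auto
      then show ?thesis
        using z by (intro image_eqI[of _ _ "(int p - z, y)"]) (auto simp: A_def f_def)
    qed
  qed
  then have card_A: "card A = p - 1"
    using card_image[OF inj] by simp
  have fin_A: "finite A"
    by (rule finite_subset[of _ "{1..<int p} \<times> {0..<int p}"]) (auto simp: A_def)
  have y_0: "y = 0" if "on_curve 0 y" "y \<in> {0..<int p}" for y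
    using that cong_p_eq[of y 0] p_gt_2 by (auto simp: on_curve_def power2_eq_square mult_cong_0_iff)
  \<comment> \<open>\<open>Infinity\<close> and \<open>Point 0 0\<close> raise the count from
    \<open>p - 1\<close> to \<open>p + 1\<close>.\<close>
  have "carrier (E_group p m) = insert Infinity (insert (Point 0 0) ((\<lambda>(x, y). Point x y) ` A))"
    (is "_ = ?S")
  proof (intro equalityI subsetI)
    fix Q assume "Q \<in> carrier (E_group p m)"
    then consider "Q = Infinity"
      | x y where "Q = Point x y" "x \<in> {0..<int p}" "y \<in> {0..<int p}" "on_curve x y"
      by (auto simp: carrier_E_group)
    then show "Q \<in> ?S"
    proof cases
      case (2 x y)
      show ?thesis
      proof (cases "x = 0")
        case True
        then show ?thesis using 2 y_0 by simp
      next
        case False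
        then have "(x, y) \<in> A" using 2 by (simp add: A_def)
        from imageI[OF this, of "\<lambda>(x, y). Point x y"] show ?thesis using 2(1) by simp
      qed
    qed simp
  next
    fix Q assume "Q \<in> ?S"
    then consider "Q = Infinity" | "Q = Point 0 0" | x y where "Q = Point x y" "(x, y) \<in> A" by auto
    then show "Q \<in> carrier (E_group p m)"
      by cases (use p_gt_2 in \<open>simp_all add: carrier_E_group A_def on_curve_def\<close>)
  qed
  moreover have "inj_on (\<lambda>(x, y). Point x y) A" by (auto simp: inj_on_def)
  then have "card ((\<lambda>(x, y). Point x y) ` A) = p - 1" by (simp add: card_image card_A)
  moreover have "Point 0 0 \<notin> (\<lambda>(x, y). Point x y) ` A" by (auto simp: A_def)
  moreover have "Infinity \<notin> insert (Point 0 0) ((\<lambda>(x, y). Point x y) ` A)" by auto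
  ultimately show ?thesis
    using p_gt_2 fin_A by (simp add: order_def)
qed

end

theorem theorem3p3:
  fixes p k :: nat and n m x y :: int
  assumes "prime p" and "[p = 3] (mod 4)"
    and "int p + 1 = 2 ^ k * n" and "k \<ge> 2" and "odd n"
    and "\<not> QuadRes (int p) m"
    and "Point x y \<in> carrier (E_group p m)"
    and "\<not> QuadRes (int p) x"
  shows "2 ^ k dvd group.ord (E_group p m) (Point x y)"
proof -
  interpret prime_3_mod_4 p
    using assms(1,2) by unfold_locales
  have "\<not> m \<doteq> 0"
    using assms(6) unfolding QuadRes_def by (metis cong_sym power_zero_numeral)
  then have "QuadRes (int p) (- m)"
    using assms(6) QuadRes_uminus by blast
  then obtain r where r: "r^2 \<doteq> - m" by (auto simp: QuadRes_def)
  have r0: "\<not> r \<doteq> 0"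
  proof
    assume r0: "r \<doteq> 0"
    have "m \<doteq> 0"
      by (rule cong_p_comb2[OF _ r r0, where ?u1.0=1 and ?u2.0="- r"]) (simp add: power2_eq_square)
    with \<open>\<not> m \<doteq> 0\<close> show False ..
  qed
  then have "\<not> 2 * r \<doteq> 0" using not_2_cong_0 by (simp add: mult_cong_0_iff)
  \<comment> \<open>One of \<open>2 * r\<close> and its negative is a residue; this fixes the sign
    of \<open>e\<close>.\<close>
  then have "QuadRes (int p) (2 * r) \<or> QuadRes (int p) (2 * - r)"
    using QuadRes_uminus by fastforce
  then obtain e w where e: "e = r \<or> e = - r" and w: "w^2 \<doteq> 2 * e"
    unfolding QuadRes_def by blast
  interpret split_curve p m e w
    using e w r r0 by unfold_locales (auto simp: cong_0_iff)
  interpret comm_group "E_group p m" by (rule comm_group_E)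
  have "int (p + 1) = int (2 ^ k) * n"
    using assms(3) by simp
  then have "int (2 ^ k) dvd int (p + 1)" by (rule dvdI)
  then have "2 ^ k dvd order (E_group p m)"
    unfolding order_E by (simp only: int_dvd_int_iff)
  \<comment> \<open>An infinite carrier would have \<open>order\<close> zero.\<close>
  moreover have "finite (carrier (E_group p m))"
    using order_E by (metis order_gt_0_iff_finite add_gr_0 zero_less_one)
  ultimately show ?thesis
  proof (intro ord_dvd_of_unique_involution)
    fix g h
    assume "g \<in> carrier (E_group p m)" "h \<in> carrier (E_group p m)"
      "g \<otimes>\<^bsub>E_group p m\<^esub> g = \<one>\<^bsub>E_group p m\<^esub>" "h \<otimes>\<^bsub>E_group p m\<^esub> h = \<one>\<^bsub>E_group p m\<^esub>"
      "g \<noteq> \<one>\<^bsub>E_group p m\<^esub>" "h \<noteq> \<one>\<^bsub>E_group p m\<^esub>"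
    then show "g = h"
      using involution_E[of g] involution_E[of h] by (simp add: one_E_group)
  next
    fix r assume "r \<in> carrier (E_group p m)"
    then show "r \<otimes>\<^bsub>E_group p m\<^esub> r \<noteq> Point x y"
      using QuadRes_abscissa_double assms(8) by blast
  qed (use assms(7) in simp_all)
qed

end
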